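(* For $a=(D,F)\in\mathbb{R}^2$ consider the dehomogenized Loud vector field \[ L_a=(-v+uv)\,\partial_u+(u+Du^2+Fv^2)\,\partial_v , \] which has a center at the origin, and consider the period function of this center on its period annulus. Then every parameter $a_0=(D_0,0)$ with $D_0\in(-1,0)$ is a local regular value of the period function at the outer boundary of the period annulus: there exist $\delta>0$ and a neighbourhood $W$ (in the Poincaré disc) of the outer boundary of the period annulus of $L_{a_0}$ such that, for every $a=(D,F)$ with $|D-D_0|<\delta$ and $|F|<\delta$, no periodic orbit of the period annulus of $L_a$ lying in $W$ is a critical point of the period function (i.e. no critical period bifurcates from the outer boundary as $a\to a_0$).
   Context: The period annulus $\mathscr P$ of a center is the largest punctured neighbourhood of it consisting of periodic orbits; the period function assigns to each periodic orbit in $\mathscr P$ its period, and critical periods are critical points of this function with respect to any analytic parametrization $s\mapsto\gamma_s$ of the periodic orbits. Compactifying $\mathbb{R}^2$ to the Poincaré disc, the outer boundary of $\mathscr P$ is a polycycle; for $F=0$ and $D\in(-1,0)$ this polycycle contains a saddle-node singularity located at infinity at the intersection of the line at infinity with $u=1$. *)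

theory Defs
  imports "HOL-Analysis.Analysis"
begin

definition loud :: "real \<Rightarrow> real \<Rightarrow> real \<times> real \<Rightarrow> real \<times> real" where
  "loud D F p = (- snd p + fst p * snd p, fst p + D * (fst p)^2 + F * (snd p)^2)"

definition is_sol :: "real \<Rightarrow> real \<Rightarrow> (real \<Rightarrow> real \<times> real) \<Rightarrow> bool" where
  "is_sol D F \<gamma> \<longleftrightarrow> (\<forall>t. (\<gamma> has_vector_derivative loud D F (\<gamma> t)) (at t))"

definition is_periodic :: "real \<Rightarrow> real \<Rightarrow> real \<times> real \<Rightarrow> bool" where
  "is_periodic D F p \<longleftrightarrow> loud D F p \<noteq> 0 \<and>
     (\<exists>\<gamma> T. is_sol D F \<gamma> \<and> \<gamma> 0 = p \<and> T > 0 \<and> (\<forall>t. \<gamma> (t + T) = \<gamma> t))"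

definition orbit :: "real \<Rightarrow> real \<Rightarrow> real \<times> real \<Rightarrow> (real \<times> real) set" where
  "orbit D F p = {q. \<exists>\<gamma> t. is_sol D F \<gamma> \<and> \<gamma> 0 = p \<and> \<gamma> t = q}"

definition period :: "real \<Rightarrow> real \<Rightarrow> real \<times> real \<Rightarrow> real" where
  "period D F p = Inf {T. T > 0 \<and> (\<exists>\<gamma>. is_sol D F \<gamma> \<and> \<gamma> 0 = p \<and> (\<forall>t. \<gamma> (t + T) = \<gamma> t))}"

text \<open>Punctured neighbourhoods of the origin (connected) consisting of periodic orbits;
  the period annulus is the largest one, i.e. their union.\<close>
definition punct_nbhd_periodic :: "real \<Rightarrow> real \<Rightarrow> (real \<times> real) set \<Rightarrow> bool" where
  "punct_nbhd_periodic D F S \<longleftrightarrow> open S \<and> (0::real\<times>real) \<notin> S \<and> connected S \<and>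
     (\<exists>e>0. ball 0 e - {0} \<subseteq> S) \<and>
     (\<forall>p\<in>S. is_periodic D F p \<and> orbit D F p \<subseteq> S)"

definition period_annulus :: "real \<Rightarrow> real \<Rightarrow> (real \<times> real) set" where
  "period_annulus D F = \<Union> {S. punct_nbhd_periodic D F S}"

text \<open>Critical period: the periodic orbit through p is critical if along some
  parametrization s \<mapsto> (orbit through \<sigma> s) of the periodic orbits by a curve \<sigma>
  that is differentiable and transversal to the flow at p = \<sigma> 0, the period
  function has zero derivative at s = 0.\<close>
definition critical_period :: "real \<Rightarrow> real \<Rightarrow> real \<times> real \<Rightarrow> bool" where
  "critical_period D F p \<longleftrightarrow>
     (\<exists>\<sigma> w. \<sigma> 0 = p \<and> (\<sigma> has_vector_derivative w) (at 0) \<and>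
        fst w * snd (loud D F p) - snd w * fst (loud D F p) \<noteq> 0 \<and>
        ((\<lambda>s. period D F (\<sigma> s)) has_real_derivative 0) (at 0))"

text \<open>Poincare compactification: R^2 onto the open unit disc; the closed unit disc is
  the Poincare disc, its boundary circle is the line at infinity.\<close>
definition pc :: "real \<times> real \<Rightarrow> real \<times> real" where
  "pc q = (1 / sqrt (1 + (norm q)^2)) *\<^sub>R q"

text \<open>Outer boundary of the period annulus in the Poincare disc (boundary minus the
  inner boundary, the origin).\<close>
definition outer_boundary :: "real \<Rightarrow> real \<Rightarrow> (real \<times> real) set" where
  "outer_boundary D F = closure (pc ` period_annulus D F) - pc ` period_annulus D F - {0}"

end

theory Submission
  imports Defs "HOL-Real_Asymp.Real_Asymp"
begin

text \<open>
  With \<open>1 - u = exp y\<close> and \<open>w = exp (- F y) v\<close> the system becomes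
  \<open>y' = exp (F y) w\<close>, \<open>w' = - exp (F y) U'(y)\<close>, with first integral
  \<open>2 U(y) + w\<^sup>2 = R\<^sup>2\<close>. Put \<open>r = sgn y sqrt (2 U(y))\<close> and \<open>(r, w) = R (cos \<theta>, - sin \<theta>)\<close>:
  then \<open>\<theta>' = 1 / K(r)\<close> for an explicit positive function \<open>K\<close> of \<open>r\<close>, so the period is
  \<open>T(R) = 2 \<integral> k(R cos \<theta>) d\<theta>\<close> over \<open>[0, \<pi>/2]\<close> with \<open>k(r) = K(r) + K(- r)\<close>.

  Since \<open>\<integral> R\<^sup>2 cos \<theta> sin \<theta> k'(R cos \<theta>) d\<theta> = \<Phi>(R)\<close> with \<open>\<Phi>(r) = r k(r) - (q(y\<^sub>+) - q(y\<^sub>-))\<close> and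
  \<open>q(y) = \<integral>\<^sub>0\<^sup>y exp (- F t) dt\<close>, replacing the weight \<open>cos \<theta>\<close> by \<open>cos \<theta> sin \<theta>\<close> evaluates \<open>T'(R)\<close>
  in terms of the turning points \<open>y\<^sub>- < 0 < y\<^sub>+\<close> alone, and the error only involves the negative part
  of \<open>k'\<close>. That part comes from the side \<open>y > 0\<close> and costs at most a multiple of \<open>exp (- F y\<^sub>+)\<close>,
  whereas \<open>\<Phi>(R)\<close> is at least \<open>q(- y\<^sub>-) - q(y\<^sub>+)\<close> up to a multiple of \<open>exp (F y\<^sub>-)\<close>.
  Near the outer boundary \<open>- y\<^sub>- - y\<^sub>+\<close> is as large as we please, uniformly in \<open>(D, F)\<close>,
  hence \<open>T' > 0\<close>.
\<close>

section \<open>The potential and the energy coordinate\<close>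

text \<open>The primitive of \<open>exp (a t)\<close> vanishing at \<open>0\<close>, defined also for \<open>a = 0\<close>; this is what makes
  the parameter \<open>F = 0\<close> unexceptional.\<close>
definition exp_prim :: "real \<Rightarrow> real \<Rightarrow> real" where
  "exp_prim a y = (if a = 0 then y else (exp (a * y) - 1) / a)"

lemma exp_prim_0 [simp]: "exp_prim a 0 = 0"
  by (simp add: exp_prim_def)

lemma DERIV_exp_prim: "(exp_prim a has_real_derivative exp (a * y)) (at y)"
proof (cases "a = 0")
  case True
  then have "exp_prim a = (\<lambda>y. y)" by (auto simp: exp_prim_def)
  then show ?thesis using True by simp
next
  case False
  then have "exp_prim a = (\<lambda>y. (exp (a * y) - 1) / a)" by (auto simp: exp_prim_def)
  then show ?thesis using False by (auto intro!: derivative_eq_intros)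
qed

lemma abs_exp_prim_le: "\<bar>exp_prim a y\<bar> \<le> \<bar>y\<bar> * exp (\<bar>a\<bar> * \<bar>y\<bar>)"
proof (cases "a = 0")
  case False
  have "\<bar>exp z - 1\<bar> \<le> \<bar>z\<bar> * exp \<bar>z\<bar>" for z :: real
  proof (cases "z \<ge> 0")
    case True
    have "exp z * (1 - z) \<le> exp z * exp (- z)"
      using exp_ge_add_one_self[of "-z"] by (intro mult_left_mono) auto
    then have "exp z * (1 - z) \<le> 1" by (simp add: exp_minus)
    with True show ?thesis by (simp add: algebra_simps)
  next
    case F: False
    have "1 - exp z \<le> - z" using exp_ge_add_one_self[of z] by linarith
    moreover have "- z * 1 \<le> - z * exp (- z)" using F by (intro mult_left_mono) auto
    moreover have "exp z \<le> 1" using F by simp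
    ultimately have "1 - exp z \<le> - z * exp (- z)" by linarith
    then show ?thesis using F by (simp add: abs_if)
  qed
  from this[of "a * y"] False show ?thesis
    by (simp add: exp_prim_def abs_mult divide_simps algebra_simps)
qed (simp add: exp_prim_def)

lemma exp_prim_nonpos_bounds:
  assumes "a > 0" "y \<le> 0"
  shows "exp_prim a y \<le> 0" "- (1 / a) \<le> exp_prim a y"
  using assms by (auto simp: exp_prim_def divide_simps mult_nonneg_nonpos)

text \<open>Turns the leading part of \<open>R * lag (- R)\<close> together with \<open>q ym\<close>
  into \<open>q (- ym)\<close> when \<open>\<Phi> R\<close> is evaluated.\<close>

lemma exp_prim_identity:
  "- 2 * exp (a * y) * exp_prim (- 2 * a) y + exp_prim (- a) y = exp_prim (- a) (- y)"
proof (cases "a = 0")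
  case False
  have "exp (a * y) * exp (- (2 * a * y)) = exp (- (a * y))"
    by (simp flip: exp_add)
  with False show ?thesis by (simp add: exp_prim_def field_simps)
qed (simp add: exp_prim_def)

text \<open>The bound 1/8 keeps the exponents \<open>1 - 2 * F\<close> and \<open>2 - 2 * F\<close>
  positive and limits the growth of \<open>exp (- 2 * F * y)\<close> to the rate 1/4.\<close>

locale loud_field =
  fixes D F :: real
  assumes D_gt: "-1 < D" and D_lt: "D < 0" and F_le: "\<bar>F\<bar> \<le> 1/8"
begin

text \<open>\<open>pot\<close> is the potential \<open>U\<close>. The functions \<open>frc\<close>, \<open>dfrc\<close> and \<open>exp (F y) * ddfrc y\<close> are its first
  three derivatives with respect to \<open>q\<close>, where \<open>dq = exp (- F y) dy\<close>, so that \<open>q'' = - frc\<close> along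
  the flow.\<close>
definition pot :: "real \<Rightarrow> real" where
  "pot y = - (1 + D) * exp_prim (- 2 * F) y + (1 + 2 * D) * exp_prim (1 - 2 * F) y
     - D * exp_prim (2 - 2 * F) y"

definition frc :: "real \<Rightarrow> real" where
  "frc y = exp (- F * y) * ((exp y - 1) * (1 + D - D * exp y))"

definition dfrc :: "real \<Rightarrow> real" where
  "dfrc y = F * (1 + D) + (1 - F) * (1 + 2 * D) * exp y - (2 - F) * D * exp y ^ 2"

definition ddfrc :: "real \<Rightarrow> real" where
  "ddfrc y = exp y * ((1 - F) * (1 + 2 * D) - 2 * (2 - F) * D * exp y)"

text \<open>The numerator of \<open>dK/dr\<close>: from \<open>K = r / frc\<close> and
  \<open>dq/dr = K\<close> follows \<open>dK/dr = (frc^2 - r^2 * dfrc) / frc^3\<close>, where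
  \<open>r^2 = 2 * pot\<close>.\<close>

definition psi :: "real \<Rightarrow> real" where
  "psi y = frc y ^ 2 - 2 * pot y * dfrc y"

lemma pot_0 [simp]: "pot 0 = 0" by (simp add: pot_def)

lemma frc_0 [simp]: "frc 0 = 0" by (simp add: frc_def)

lemma dfrc_0 [simp]: "dfrc 0 = 1" by (simp add: dfrc_def algebra_simps)

lemma lin_pos: "1 + D - D * exp y > 0"
  using D_gt mult_neg_pos[OF D_lt, of "exp y"] by (simp del: mult_less_0_iff)

lemma frc_pos_iff: "frc y > 0 \<longleftrightarrow> y > 0"
  using lin_pos[of y] by (auto simp: frc_def zero_less_mult_iff)

lemma frc_neg_iff: "frc y < 0 \<longleftrightarrow> y < 0"
  using lin_pos[of y] by (auto simp: frc_def mult_less_0_iff zero_less_mult_iff)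

lemma frc_eq_0_iff [simp]: "frc y = 0 \<longleftrightarrow> y = 0"
  using lin_pos[of y] by (auto simp: frc_def)

lemma DERIV_pot: "(pot has_real_derivative exp (- F * y) * frc y) (at y)"
proof -
  have e: "exp ((1 - 2 * F) * y) = exp (- F * y) * (exp (- F * y) * exp y)"
    "exp ((2 - 2 * F) * y) = exp (- F * y) * (exp (- F * y) * exp y ^ 2)"
    "exp (- 2 * F * y) = exp (- F * y) * exp (- F * y)"
    by (simp_all flip: exp_add add: power2_eq_square algebra_simps)
  have "(pot has_real_derivative (- (1 + D) * exp (- 2 * F * y)
      + (1 + 2 * D) * exp ((1 - 2 * F) * y) - D * exp ((2 - 2 * F) * y))) (at y)"
    unfolding pot_def by (intro DERIV_add DERIV_diff DERIV_cmult DERIV_exp_prim)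
  also have "(- (1 + D) * exp (- 2 * F * y)
      + (1 + 2 * D) * exp ((1 - 2 * F) * y) - D * exp ((2 - 2 * F) * y)) = exp (- F * y) * frc y"
    unfolding e frc_def by (simp add: algebra_simps power2_eq_square)
  finally show ?thesis .
qed

lemma DERIV_frc: "(frc has_real_derivative exp (- F * y) * dfrc y) (at y)"
  unfolding frc_def dfrc_def
  by (auto intro!: derivative_eq_intros simp: algebra_simps power2_eq_square)

lemma DERIV_dfrc: "(dfrc has_real_derivative ddfrc y) (at y)"
  unfolding dfrc_def ddfrc_def
  by (auto intro!: derivative_eq_intros simp: algebra_simps power2_eq_square)

text \<open>The products of first and second derivatives of the potential cancel. Only the third
  derivative remains, so the sign of \<open>ddfrc\<close> governs the monotonicity of
  \<open>psi\<close>.\<close>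

lemma DERIV_psi: "(psi has_real_derivative - 2 * pot y * ddfrc y) (at y)"
  unfolding psi_def
  by (auto intro!: derivative_eq_intros DERIV_frc DERIV_dfrc DERIV_pot simp: algebra_simps)

lemma isCont_pot: "isCont pot y" and isCont_frc: "isCont frc y"
  and isCont_dfrc: "isCont dfrc y" and isCont_psi: "isCont psi y"
  using DERIV_pot DERIV_frc DERIV_dfrc DERIV_psi DERIV_isCont by blast+

lemma isCont_ddfrc: "isCont ddfrc y"
  unfolding ddfrc_def by (intro continuous_intros)

lemma pot_strict_mono: "0 \<le> a \<Longrightarrow> a < b \<Longrightarrow> pot a < pot b"
  by (rule DERIV_pos_imp_increasing_open[of a b pot])
    (auto intro!: exI DERIV_pot continuous_at_imp_continuous_on isCont_pot mult_pos_pos simp: frc_pos_iff)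

lemma pot_strict_antimono: "a < b \<Longrightarrow> b \<le> 0 \<Longrightarrow> pot b < pot a"
  by (rule DERIV_neg_imp_decreasing_open[of a b pot])
    (auto intro!: exI DERIV_pot continuous_at_imp_continuous_on isCont_pot mult_pos_neg simp: frc_neg_iff)

lemma pot_pos: "y \<noteq> 0 \<Longrightarrow> pot y > 0"
  using pot_strict_mono[of 0 y] pot_strict_antimono[of y 0] by (cases "y > 0") auto

lemma pot_nonneg: "pot y \<ge> 0"
  using pot_pos[of y] by (cases "y = 0") auto

section \<open>The energy coordinate \<open>r\<close> and the function \<open>K\<close>\<close>

definition rad :: "real \<Rightarrow> real" where
  "rad y = sgn y * sqrt (2 * pot y)"

lemma rad_0 [simp]: "rad 0 = 0" by (simp add: rad_def)

lemma rad_sq: "rad y ^ 2 = 2 * pot y"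
  using pot_nonneg[of y] by (cases "y = 0") (auto simp: rad_def power_mult_distrib sgn_real_def)

lemma rad_pos: "y > 0 \<Longrightarrow> rad y > 0" using pot_pos[of y] by (simp add: rad_def)

lemma rad_neg: "y < 0 \<Longrightarrow> rad y < 0" using pot_pos[of y] by (simp add: rad_def)

lemma rad_eq_0_iff [simp]: "rad y = 0 \<longleftrightarrow> y = 0"
  using rad_pos[of y] rad_neg[of y] by (cases "y = 0") force+

text \<open>The function \<open>K = dq/dr\<close> and its derivative \<open>dK/dr\<close>, both expressed in \<open>y\<close>; the values at
  \<open>y = 0\<close> are the limits.\<close>
definition spd :: "real \<Rightarrow> real" where
  "spd y = (if y = 0 then 1 else rad y / frc y)"

definition dspd :: "real \<Rightarrow> real" where
  "dspd y = (if y = 0 then - ddfrc 0 / 3 else psi y / frc y ^ 3)"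

lemma spd_pos: "spd y > 0"
  using rad_pos[of y] rad_neg[of y] frc_pos_iff[of y] frc_neg_iff[of y]
  by (auto simp: spd_def zero_less_divide_iff neq_iff)

lemma frc_over_id: "((\<lambda>y. frc y / y) \<longlongrightarrow> 1) (at 0)"
  using DERIV_frc[of 0] by (simp add: DERIV_def)

lemma pot_over_sq: "((\<lambda>y. 2 * pot y / y ^ 2) \<longlongrightarrow> 1) (at 0)"
proof (rule lhopital[where f' = "\<lambda>y. 2 * (exp (- F * y) * frc y)" and g' = "\<lambda>y. 2 * y"])
  show "((\<lambda>y. 2 * pot y) \<longlongrightarrow> 0) (at 0)"
    using isCont_pot[of 0] by (auto intro!: tendsto_eq_intros simp: isCont_def)
  have "((\<lambda>y. exp (- F * y) * (frc y / y)) \<longlongrightarrow> exp (- F * 0) * 1) (at 0)"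
    by (intro tendsto_intros frc_over_id)
  then show "((\<lambda>y. 2 * (exp (- F * y) * frc y) / (2 * y)) \<longlongrightarrow> 1) (at 0)" by simp
  show "\<forall>\<^sub>F y in at 0. ((\<lambda>y. 2 * pot y) has_real_derivative 2 * (exp (- F * y) * frc y)) (at y)"
    by (intro always_eventually allI DERIV_cmult DERIV_pot)
  show "\<forall>\<^sub>F y in at 0. ((\<lambda>y. y\<^sup>2) has_real_derivative 2 * y) (at y)"
    by (intro always_eventually allI) (auto intro!: derivative_eq_intros)
qed (auto intro!: tendsto_eq_intros simp: eventually_at_filter)

lemma rad_over_id: "((\<lambda>y. rad y / y) \<longlongrightarrow> 1) (at 0)"
proof -
  have "((\<lambda>y. sqrt (2 * pot y / y ^ 2)) \<longlongrightarrow> 1) (at 0)"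
    using tendsto_real_sqrt[OF pot_over_sq] by simp
  moreover have "sqrt (2 * pot y / y ^ 2) = rad y / y" for y
    by (auto simp: rad_def real_sqrt_divide sgn_real_def)
  ultimately show ?thesis by simp
qed

lemma isCont_spd: "isCont spd y"
proof (cases "y = 0")
  case True
  have "((\<lambda>y. (rad y / y) / (frc y / y)) \<longlongrightarrow> 1 / 1) (at 0)"
    by (intro tendsto_divide rad_over_id frc_over_id) auto
  then have "((\<lambda>y. (rad y / y) / (frc y / y)) \<longlongrightarrow> 1) (at 0)" by simp
  then have "(spd \<longlongrightarrow> 1) (at 0)"
    by (rule Lim_transform_eventually) (auto simp: eventually_at_filter spd_def)
  then show ?thesis using True by (simp add: isCont_def spd_def)
next
  case False
  have c: "isCont (\<lambda>y. sgn c * sqrt (2 * pot y) / frc y) y" for c :: real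
    using False by (intro continuous_intros isCont_pot isCont_frc) auto
  have "eventually (\<lambda>z. spd z = sgn y * sqrt (2 * pot z) / frc z) (nhds y)"
  proof (cases "y > 0")
    case True
    then show ?thesis
      by (intro eventually_mono[OF eventually_nhds_in_open[of "{0<..}"]]) (auto simp: spd_def rad_def)
  next
    case F: False
    then show ?thesis using False
      by (intro eventually_mono[OF eventually_nhds_in_open[of "{..<0}"]]) (auto simp: spd_def rad_def)
  qed
  then show ?thesis using c[of y] isCont_cong by fast
qed

lemma DERIV_rad: "(rad has_real_derivative exp (- F * y) / spd y) (at y)"
proof (cases "y = 0")
  case True
  then show ?thesis using rad_over_id by (simp add: DERIV_def spd_def)
next
  case False
  have d: "((\<lambda>z. sgn y * sqrt (2 * pot z)) has_real_derivative exp (- F * y) / spd y) (at y)"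
  proof -
    have p: "2 * pot y > 0" using pot_pos[OF False] by simp
    have "((\<lambda>z. sqrt (2 * pot z)) has_real_derivative
        inverse (sqrt (2 * pot y)) / 2 * (2 * (exp (- F * y) * frc y))) (at y)"
      by (rule DERIV_chain2[where f = sqrt and g = "\<lambda>z. 2 * pot z"])
        (intro DERIV_real_sqrt p DERIV_cmult DERIV_pot)+
    then have "((\<lambda>z. sgn y * sqrt (2 * pot z)) has_real_derivative
        sgn y * (inverse (sqrt (2 * pot y)) / 2 * (2 * (exp (- F * y) * frc y)))) (at y)"
      by (rule DERIV_cmult)
    also have "sgn y * (inverse (sqrt (2 * pot y)) / 2 * (2 * (exp (- F * y) * frc y)))
        = exp (- F * y) / spd y"
      using False p by (simp add: spd_def rad_def sgn_real_def divide_simps)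
    finally show ?thesis .
  qed
  have "eventually (\<lambda>z. sgn y * sqrt (2 * pot z) = rad z) (nhds y)"
  proof (cases "y > 0")
    case True
    then show ?thesis
      by (intro eventually_mono[OF eventually_nhds_in_open[of "{0<..}"]]) (auto simp: rad_def)
  next
    case F: False
    then show ?thesis using False
      by (intro eventually_mono[OF eventually_nhds_in_open[of "{..<0}"]]) (auto simp: rad_def)
  qed
  then show ?thesis using DERIV_cong_ev[OF refl _ refl, THEN iffD1, OF _ d] by blast
qed

lemma isCont_dspd: "isCont dspd y"
proof (cases "y = 0")
  case True
  have "((\<lambda>y. psi y / frc y ^ 3) \<longlongrightarrow> - ddfrc 0 / 3) (at 0)"
  proof (rule lhopital[where f' = "\<lambda>y. - 2 * pot y * ddfrc y"
        and g' = "\<lambda>y. 3 * frc y ^ 2 * (exp (- F * y) * dfrc y)"])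
    show "(psi \<longlongrightarrow> 0) (at 0)"
      using isCont_psi[of 0] by (simp add: isCont_def psi_def)
    show "((\<lambda>y. frc y ^ 3) \<longlongrightarrow> 0) (at 0)"
      using isCont_frc[of 0] by (auto intro!: tendsto_eq_intros simp: isCont_def)
    have "(dfrc \<longlongrightarrow> 1) (at 0)" using isCont_dfrc[of 0] by (simp add: isCont_def)
    then have "eventually (\<lambda>y. dfrc y > 0) (at 0)" by (rule order_tendstoD) simp
    then show "eventually (\<lambda>y. 3 * frc y ^ 2 * (exp (- F * y) * dfrc y) \<noteq> 0) (at 0)"
      by (auto simp: eventually_at_filter elim: eventually_mono)
    have dd: "(ddfrc \<longlongrightarrow> ddfrc 0) (at 0)" using isCont_ddfrc[of 0] by (simp add: isCont_def)
    \<comment> \<open>Dividing by \<open>y^2\<close> exposes two quotients of limit 1, so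
      \<open>2 * pot / frc^2\<close> tends to 1 and \<open>- ddfrc 0 / 3\<close> is left.\<close>
    have "((\<lambda>y. - ((2 * pot y / y ^ 2) / (frc y / y) ^ 2) * ddfrc y / (3 * (exp (- F * y) * dfrc y)))
        \<longlongrightarrow> - (1 / 1 ^ 2) * ddfrc 0 / (3 * (exp (- F * 0) * 1))) (at 0)"
      by (intro tendsto_intros pot_over_sq frc_over_id dd \<open>(dfrc \<longlongrightarrow> 1) (at 0)\<close>) auto
    then show "((\<lambda>y. (- 2 * pot y * ddfrc y) / (3 * frc y ^ 2 * (exp (- F * y) * dfrc y)))
        \<longlongrightarrow> - ddfrc 0 / 3) (at 0)"
      by (rule Lim_transform_eventually[THEN tendsto_eq_rhs])
        (auto simp: eventually_at_filter power_divide)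
    show "\<forall>\<^sub>F y in at 0. (psi has_real_derivative - 2 * pot y * ddfrc y) (at y)"
      by (intro always_eventually allI DERIV_psi)
    show "\<forall>\<^sub>F y in at 0. ((\<lambda>y. frc y ^ 3) has_real_derivative
        3 * frc y ^ 2 * (exp (- F * y) * dfrc y)) (at y)"
      by (intro always_eventually allI) (auto intro!: derivative_eq_intros DERIV_frc)
  qed (auto simp: eventually_at_filter)
  then have "(dspd \<longlongrightarrow> - ddfrc 0 / 3) (at 0)"
    by (rule Lim_transform_eventually) (auto simp: eventually_at_filter dspd_def)
  then show ?thesis using True by (simp add: isCont_def dspd_def)
next
  case False
  have c: "isCont (\<lambda>y. psi y / frc y ^ 3) y"
    using False by (intro continuous_intros isCont_psi isCont_frc) auto
  have "eventually (\<lambda>z. dspd z = psi z / frc z ^ 3) (nhds y)"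
    using False by (intro eventually_mono[OF eventually_nhds_in_open[of "-{0}"]]) (auto simp: dspd_def)
  then show ?thesis using c isCont_cong by fast
qed

text \<open>Away from 0 this is the quotient rule with \<open>rad^2 = 2 * pot\<close>; at 0
  l'Hospital carries the limit of that derivative over to the difference quotient.\<close>

lemma DERIV_spd: "(spd has_real_derivative dspd y * (exp (- F * y) / spd y)) (at y)"
proof -
  have nz: "(spd has_real_derivative dspd y * (exp (- F * y) / spd y)) (at y)" if "y \<noteq> 0" for y
  proof -
    have "((\<lambda>y. rad y / frc y) has_real_derivative
        (exp (- F * y) / spd y * frc y - rad y * (exp (- F * y) * dfrc y)) / (frc y * frc y)) (at y)"
      using that by (intro DERIV_divide DERIV_rad DERIV_frc) auto
    also have "(exp (- F * y) / spd y * frc y - rad y * (exp (- F * y) * dfrc y)) / (frc y * frc y)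
        = dspd y * (exp (- F * y) / spd y)"
    proof -
      have "psi y = frc y ^ 2 - rad y ^ 2 * dfrc y" by (simp add: psi_def rad_sq)
      then show ?thesis using that
        by (simp add: dspd_def spd_def divide_simps) (simp add: algebra_simps power2_eq_square power3_eq_cube)
    qed
    finally show ?thesis
      by (rule has_field_derivative_transform_within_open[where S = "-{0}"])
        (use that in \<open>auto simp: spd_def\<close>)
  qed
  show ?thesis
  proof (cases "y = 0")
    case True
    have "((\<lambda>y. (spd y - 1) / y) \<longlongrightarrow> dspd 0) (at 0)"
    proof (rule lhopital[where f' = "\<lambda>y. dspd y * (exp (- F * y) / spd y)" and g' = "\<lambda>_. 1"])
      show "((\<lambda>y. spd y - 1) \<longlongrightarrow> 0) (at 0)"
        using isCont_spd[of 0] LIM_zero[of spd 1] by (simp add: isCont_def spd_def[of 0])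
      have "isCont (\<lambda>y. dspd y * (exp (- F * y) / spd y) / 1) 0"
        using spd_pos[of 0] by (intro continuous_intros isCont_spd isCont_dspd) auto
      then show "((\<lambda>y. dspd y * (exp (- F * y) / spd y) / 1) \<longlongrightarrow> dspd 0) (at 0)"
        by (simp add: isCont_def spd_def)
      show "\<forall>\<^sub>F y in at 0. ((\<lambda>y. spd y - 1) has_real_derivative
          dspd y * (exp (- F * y) / spd y)) (at y)"
        using nz by (auto simp: eventually_at_filter intro!: always_eventually derivative_eq_intros)
    qed (auto intro!: derivative_eq_intros simp: eventually_at_filter)
    then show ?thesis using True by (simp add: DERIV_def spd_def)
  qed (rule nz)
qed

end

section \<open>Uniform estimates\<close>

lemma exp_prim_eq: "exp (a * y) = 1 + a * exp_prim a y"
  by (simp add: exp_prim_def)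

lemma tendsto_exp_prim_at_bot:
  assumes "a > 0"
  shows "(exp_prim a \<longlongrightarrow> - (1 / a)) at_bot"
proof -
  have "((\<lambda>y. (exp (a * y) - 1) / a) \<longlongrightarrow> - (1 / a)) at_bot"
    using assms by (real_asymp simp: inverse_eq_divide)
  then show ?thesis using assms by (simp add: exp_prim_def[abs_def])
qed

text \<open>The integrand \<open>exp (- F * t)\<close> is monotone, so its larger end value is at
  \<open>a\<close> or at \<open>b\<close>. On the stretch of length \<open>Z\<close> next to that
  end it keeps at least half of this value, as
  \<open>exp (- \<bar>F\<bar> * Z) \<ge> 1/2\<close>.\<close>

lemma exp_prim_diff_ge:
  assumes "a + Z \<le> b" "Z \<ge> 0" "\<bar>F\<bar> * Z \<le> 1/2"
  shows "exp_prim (- F) b - exp_prim (- F) a \<ge> Z / 2 * max (exp (- F * a)) (exp (- F * b))"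
proof -
  have mono: "exp_prim (- F) s \<le> exp_prim (- F) t" if "s \<le> t" for s t
    by (rule DERIV_nonneg_imp_nondecreasing[OF that]) (use DERIV_exp_prim[of "- F"] in force)
  have step: "exp_prim (- F) (s + Z) - exp_prim (- F) s \<ge> Z * m"
    if m: "\<And>t. s \<le> t \<Longrightarrow> t \<le> s + Z \<Longrightarrow> m \<le> exp (- F * t)" for s m
  proof (cases "Z = 0")
    case False
    then have "s < s + Z" using assms by simp
    then obtain z where z: "s < z" "z < s + Z"
      "exp_prim (- F) (s + Z) - exp_prim (- F) s = (s + Z - s) * exp (- F * z)"
      using MVT2[of s "s + Z" "exp_prim (- F)" "\<lambda>y. exp (- F * y)"] DERIV_exp_prim[of "- F"] by blast
    then show ?thesis using m[of z] assms(2) by (simp add: mult_left_mono)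
  qed simp
  have half: "exp (- \<bar>F\<bar> * Z) \<ge> 1/2" using exp_ge_add_one_self[of "- \<bar>F\<bar> * Z"] assms by simp
  show ?thesis
  proof (cases "F \<ge> 0")
    case True
    have "exp (- F * a) / 2 \<le> exp (- F * t)" if "t \<le> a + Z" for t
    proof -
      have "exp (- F * a) * (1/2) \<le> exp (- F * a) * exp (- \<bar>F\<bar> * Z)"
        using half by (intro mult_left_mono) auto
      also have "\<dots> = exp (- F * (a + Z))" using True by (simp flip: exp_add add: algebra_simps)
      also have "\<dots> \<le> exp (- F * t)" using True that by (simp add: mult_left_mono)
      finally show ?thesis by simp
    qed
    then have "Z * (exp (- F * a) / 2) \<le> exp_prim (- F) (a + Z) - exp_prim (- F) a" by (intro step) auto
    moreover have "exp (- F * b) \<le> exp (- F * a)" using True assms by (simp add: mult_left_mono)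
    then have "max (exp (- F * a)) (exp (- F * b)) = exp (- F * a)" by (rule max_absorb1)
    ultimately show ?thesis using mono[OF assms(1)] by simp
  next
    case False
    have "exp (- F * b) / 2 \<le> exp (- F * t)" if "b - Z \<le> t" for t
    proof -
      have "exp (- F * b) * (1/2) \<le> exp (- F * b) * exp (- \<bar>F\<bar> * Z)"
        using half by (intro mult_left_mono) auto
      also have "\<dots> = exp (- F * (b - Z))" using False by (simp flip: exp_add add: algebra_simps)
      also have "\<dots> \<le> exp (- F * t)" using False that by simp
      finally show ?thesis by simp
    qed
    then have "Z * (exp (- F * b) / 2) \<le> exp_prim (- F) (b - Z + Z) - exp_prim (- F) (b - Z)"
      by (intro step) auto
    moreover have "exp (- F * a) \<le> exp (- F * b)" using False assms by simp
    moreover have "exp_prim (- F) a \<le> exp_prim (- F) (b - Z)" using assms by (intro mono) auto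
    moreover have "max (exp (- F * a)) (exp (- F * b)) = exp (- F * b)"
      using \<open>exp (- F * a) \<le> exp (- F * b)\<close> by (rule max_absorb2)
    ultimately show ?thesis by simp
  qed
qed

section \<open>The half-line \<open>y < 0\<close>\<close>

context loud_field
begin

text \<open>As \<open>y \<longlongrightarrow> -\<infinity>\<close> only the first of the three terms of \<open>pot\<close> can be unbounded.\<close>
definition lin_part :: "real \<Rightarrow> real" where
  "lin_part y = - exp_prim (- 2 * F) y"

definition rest_part :: "real \<Rightarrow> real" where
  "rest_part y = 2 * (1 + 2 * D) * exp_prim (1 - 2 * F) y - 2 * D * exp_prim (2 - 2 * F) y"

lemma pot_split: "2 * pot y = 2 * (1 + D) * lin_part y + rest_part y"
  by (simp add: pot_def lin_part_def rest_part_def algebra_simps)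

lemma D_abs: "\<bar>D\<bar> \<le> 1" "\<bar>1 + 2 * D\<bar> \<le> 1"
  using D_gt D_lt by auto

lemma rest_part_bound:
  assumes "y \<le> 0" shows "\<bar>rest_part y\<bar> \<le> 4"
proof -
  have F: "-1/8 \<le> F" "F \<le> 1/8" using F_le by auto
  have "\<bar>exp_prim (1 - 2 * F) y\<bar> \<le> 1 / (1 - 2 * F)" "1 / (1 - 2 * F) \<le> 4/3"
    using exp_prim_nonpos_bounds[of "1 - 2 * F" y] F assms by (auto simp: divide_simps)
  then have 1: "\<bar>exp_prim (1 - 2 * F) y\<bar> \<le> 4/3" by linarith
  have "\<bar>exp_prim (2 - 2 * F) y\<bar> \<le> 1 / (2 - 2 * F)" "1 / (2 - 2 * F) \<le> 4/7"
    using exp_prim_nonpos_bounds[of "2 - 2 * F" y] F assms by (auto simp: divide_simps)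
  then have 2: "\<bar>exp_prim (2 - 2 * F) y\<bar> \<le> 4/7" by linarith
  have "\<bar>(1 + 2 * D) * exp_prim (1 - 2 * F) y\<bar> \<le> 1 * (4/3)"
    unfolding abs_mult by (intro mult_mono D_abs 1) auto
  moreover have "\<bar>D * exp_prim (2 - 2 * F) y\<bar> \<le> 1 * (4/7)"
    unfolding abs_mult by (intro mult_mono D_abs 2) auto
  ultimately show ?thesis unfolding rest_part_def by linarith
qed

lemma lin_part_abs:
  assumes "y \<le> 0" shows "\<bar>lin_part y\<bar> \<le> - y * exp (- y / 4)"
proof -
  have "\<bar>lin_part y\<bar> \<le> \<bar>y\<bar> * exp (\<bar>- 2 * F\<bar> * \<bar>y\<bar>)"
    unfolding lin_part_def abs_minus by (rule abs_exp_prim_le)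
  also have "\<dots> \<le> - y * exp (- y / 4)"
  proof -
    have "\<bar>- 2 * F\<bar> * \<bar>y\<bar> \<le> 1/4 * \<bar>y\<bar>" using F_le by (intro mult_right_mono) auto
    then have "exp (\<bar>- 2 * F\<bar> * \<bar>y\<bar>) \<le> exp (- y / 4)" using assms by simp
    then show ?thesis using assms by (intro mult_mono) auto
  qed
  finally show ?thesis .
qed

lemma lin_part_nonneg: "y \<le> 0 \<Longrightarrow> lin_part y \<ge> 0"
proof -
  assume "y \<le> 0"
  then have "exp_prim (- 2 * F) y \<le> exp_prim (- 2 * F) 0"
    by (rule DERIV_nonneg_imp_nondecreasing) (use DERIV_exp_prim[of "- 2 * F"] in force)
  then show ?thesis by (simp add: lin_part_def)
qed

lemma lin_part_exp_abs:
  assumes "y \<le> 0" shows "\<bar>lin_part y * exp y\<bar> \<le> - y * exp (3 * y / 4)"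
proof -
  have "\<bar>lin_part y * exp y\<bar> \<le> (- y * exp (- y / 4)) * exp y"
    unfolding abs_mult abs_exp_cancel by (intro mult_right_mono lin_part_abs assms) simp
  also have "\<dots> = - y * exp (3 * y / 4)" by (simp flip: exp_add)
  finally show ?thesis .
qed

text \<open>The terms \<open>2 * F * (1 + D)^2 * lin_part y\<close> from \<open>frc^2\<close> and
  from \<open>2 * pot * dfrc\<close> cancel. Every remaining \<open>lin_part\<close> is damped by
  \<open>exp y\<close>, so \<open>psi\<close> has a limit at \<open>-\<infinity>\<close>.\<close>

lemma psi_expand:
  fixes y defines "X \<equiv> exp y"
  defines "A \<equiv> (- (1 + 2 * D) + D * X) * (2 * (1 + D) - (1 + 2 * D) * X + D * X\<^sup>2)"
    and "B \<equiv> (1 - F) * (1 + 2 * D) - (2 - F) * D * X"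
  shows "psi y = (1 + D - (1 + 2 * D) * X + D * X\<^sup>2)\<^sup>2
     + (lin_part y * X) * (2 * F * A - 2 * (1 + D) * B) - rest_part y * (F * (1 + D) + X * B)"
proof -
  have e: "exp (- F * y) ^ 2 = 1 + 2 * F * lin_part y"
    using exp_prim_eq[of "- 2 * F" y] by (simp add: lin_part_def mult.assoc flip: exp_double)
  have "frc y ^ 2 = (1 + 2 * F * lin_part y) * ((X - 1) * (1 + D - D * X))\<^sup>2"
    unfolding frc_def power_mult_distrib e X_def by simp
  moreover have "dfrc y = F * (1 + D) + X * B"
    by (simp add: dfrc_def X_def B_def algebra_simps power2_eq_square)
  ultimately have "psi y = (1 + 2 * F * lin_part y) * ((X - 1) * (1 + D - D * X))\<^sup>2
      - (2 * (1 + D) * lin_part y + rest_part y) * (F * (1 + D) + X * B)"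
    unfolding psi_def pot_split by simp
  moreover have "((X - 1) * (1 + D - D * X))\<^sup>2 = (1 + D)\<^sup>2 + X * A"
    by (simp add: A_def algebra_simps power2_eq_square)
  moreover have "(1 + D - (1 + 2 * D) * X + D * X\<^sup>2)\<^sup>2 = (1 + D)\<^sup>2 + X * A"
    by (simp add: A_def algebra_simps power2_eq_square)
  moreover have "(1 + 2 * F * P) * (m\<^sup>2 + X * A) - (2 * m * P + c) * (F * m + X * B)
      = m\<^sup>2 + X * A + P * X * (2 * F * A - 2 * m * B) - c * (F * m + X * B)" for m P c
    by (simp add: algebra_simps power2_eq_square)
  ultimately show ?thesis by (simp only:)
qed

text \<open>The limit is \<open>(1 + D) * (1 + D - c * F)\<close> with \<open>c\<close> the limit of
  \<open>rest_part\<close>. Since \<open>\<bar>c\<bar> \<le> 4\<close> and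
  \<open>\<bar>F\<bar> \<le> d / 8\<close>, the correction is at most \<open>d / 2\<close>, less
  than \<open>1 + D\<close>.\<close>

lemma psi_eventually_pos:
  assumes "d > 0" "d \<le> 1 + D" "\<bar>F\<bar> \<le> d / 8"
  shows "eventually (\<lambda>y. psi y > 0) at_bot"
proof -
  define c where "c = 2 * (1 + 2 * D) * (- (1 / (1 - 2 * F))) - 2 * D * (- (1 / (2 - 2 * F)))"
  have F: "1 - 2 * F > 0" "2 - 2 * F > 0" using F_le by auto
  have X: "((\<lambda>y::real. exp y) \<longlongrightarrow> 0) at_bot" by real_asymp
  have r: "(rest_part \<longlongrightarrow> c) at_bot"
    unfolding rest_part_def c_def by (intro tendsto_intros tendsto_exp_prim_at_bot F)
  have l: "((\<lambda>y. lin_part y * exp y) \<longlongrightarrow> 0) at_bot"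
  proof (rule Lim_null_comparison)
    show "eventually (\<lambda>y. norm (lin_part y * exp y) \<le> - y * exp (3 * y / 4)) at_bot"
      using lin_part_exp_abs by (auto intro!: eventually_at_bot_linorderI[of 0])
    show "((\<lambda>y::real. - y * exp (3 * y / 4)) \<longlongrightarrow> 0) at_bot" by real_asymp
  qed
  define L where "L = (1 + D)\<^sup>2 - c * (F * (1 + D))"
  have "(psi \<longlongrightarrow> (1 + D - (1 + 2 * D) * 0 + D * 0\<^sup>2)\<^sup>2
     + 0 * (2 * F * ((- (1 + 2 * D) + D * 0) * (2 * (1 + D) - (1 + 2 * D) * 0 + D * 0\<^sup>2))
        - 2 * (1 + D) * ((1 - F) * (1 + 2 * D) - (2 - F) * D * 0))
     - c * (F * (1 + D) + 0 * ((1 - F) * (1 + 2 * D) - (2 - F) * D * 0))) at_bot"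
    unfolding psi_expand by (intro tendsto_intros X l r)
  then have "(psi \<longlongrightarrow> L) at_bot" by (simp add: L_def)
  moreover have "L > 0"
  proof -
    have "\<bar>c\<bar> \<le> 4"
      by (rule tendsto_upperbound[OF tendsto_rabs[OF r]])
        (auto intro!: eventually_at_bot_linorderI[of 0] rest_part_bound)
    then have "\<bar>c * F\<bar> \<le> 4 * (d / 8)" unfolding abs_mult using assms by (intro mult_mono) auto
    then have "1 + D - c * F > 0" using assms by linarith
    then have "(1 + D) * (1 + D - c * F) > 0" using D_gt by simp
    then show ?thesis unfolding L_def by (simp add: algebra_simps power2_eq_square)
  qed
  ultimately show ?thesis by (rule order_tendstoD)
qed

text \<open>On the half-line \<open>y < 0\<close> the function \<open>psi\<close> either decreases to \<open>psi 0 = 0\<close>, or first increases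
  from its positive limit at \<open>-\<infinity>\<close>, since \<open>ddfrc\<close> changes sign at most once.\<close>
lemma psi_nonneg_left:
  assumes "d > 0" "d \<le> 1 + D" "\<bar>F\<bar> \<le> d / 8" "y \<le> 0"
  shows "psi y \<ge> 0"
proof -
  \<comment> \<open>\<open>b\<close> carries the sign of \<open>ddfrc\<close> and is nondecreasing
    because \<open>D < 0\<close>.\<close>
  define b where "b = (\<lambda>y. (1 - F) * (1 + 2 * D) - 2 * (2 - F) * D * exp y)"
  have dd: "ddfrc y = exp y * b y" for y by (simp add: ddfrc_def b_def)
  have bm: "b s \<le> b t" if "s \<le> t" for s t
  proof -
    have "(2 - F) * (- D) * exp s \<le> (2 - F) * (- D) * exp t"
      using that F_le D_lt by (intro mult_left_mono mult_nonneg_nonneg) auto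
    then show ?thesis unfolding b_def by linarith
  qed
  show ?thesis
  proof (cases "b y \<ge> 0")
    case True
    have "psi 0 \<le> psi y"
    proof (rule DERIV_nonpos_imp_nonincreasing[OF assms(4)])
      fix t assume "y \<le> t"
      then have "b t \<ge> 0" using bm[of y t] True by linarith
      then show "\<exists>z. (psi has_real_derivative z) (at t) \<and> z \<le> 0"
        using DERIV_psi[of t] pot_nonneg[of t] by (intro exI conjI) (auto simp: dd)
    qed
    then show ?thesis by (simp add: psi_def)
  next
    case False
    obtain z where z: "z \<le> y" "psi z > 0"
      using eventually_conj[OF psi_eventually_pos[OF assms(1-3)] eventually_le_at_bot[of y]]
      by (auto dest!: eventually_happens)
    have "psi z \<le> psi y"
    proof (rule DERIV_nonneg_imp_nondecreasing[OF z(1)])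
      fix t assume "t \<le> y"
      then have "b t \<le> 0" using bm[of t y] False by linarith
      then have "- 2 * pot t * ddfrc t \<ge> 0"
        using pot_nonneg[of t] by (auto simp: dd mult_nonneg_nonpos)
      then show "\<exists>z. (psi has_real_derivative z) (at t) \<and> z \<ge> 0"
        using DERIV_psi[of t] by blast
    qed
    then show ?thesis using z by simp
  qed
qed

lemma dspd_nonpos_left:
  assumes "d > 0" "d \<le> 1 + D" "\<bar>F\<bar> \<le> d / 8" "y < 0"
  shows "dspd y \<le> 0"
proof -
  have "frc y < 0" using assms by (simp add: frc_neg_iff)
  then have "frc y ^ 3 < 0" by (simp add: power3_eq_cube mult_pos_neg mult_neg_neg)
  then show ?thesis using psi_nonneg_left[OF assms(1-3)] assms(4)
    by (simp add: dspd_def divide_nonneg_neg)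
qed

section \<open>The half-line \<open>y > 0\<close>\<close>

definition dpot :: "real \<Rightarrow> real" where "dpot y = exp (- F * y) * frc y"

lemma dpot_nonneg: "y \<ge> 0 \<Longrightarrow> dpot y \<ge> 0"
  using frc_pos_iff[of y] by (cases "y = 0") (auto simp: dpot_def)

text \<open>With \<open>x = exp y\<close>, the derivative minus \<open>dpot y / 2\<close> is
  \<open>exp (- F * y) ^ 2\<close> times a combination of \<open>1 + D\<close> and
  \<open>- D * x\<close> whose coefficients are nonnegative for \<open>x \<ge> 1\<close> and
  \<open>\<bar>F\<bar> \<le> 1/8\<close>.\<close>

lemma DERIV_dpot_ge:
  assumes "y \<ge> 0"
  shows "\<exists>z. (dpot has_real_derivative z) (at y) \<and> dpot y / 2 \<le> z"
proof (intro exI conjI)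
  define x e where "x = exp y" and "e = exp (- F * y)"
  define z where "z = e\<^sup>2 * (2 * F * (1 + D) + (1 - 2 * F) * (1 + 2 * D) * x - (2 - 2 * F) * D * x\<^sup>2)"
  have "(dpot has_real_derivative (- F * e * frc y + e * (e * dfrc y))) (at y)"
    unfolding dpot_def e_def
    by (auto intro!: derivative_eq_intros DERIV_frc)
  also have "- F * e * frc y + e * (e * dfrc y) = z"
    unfolding z_def frc_def dfrc_def e_def[symmetric] x_def[symmetric]
    by (simp add: algebra_simps power2_eq_square)
  finally show "(dpot has_real_derivative z) (at y)" .
  have F: "-1/8 \<le> F" "F \<le> 1/8" using F_le by auto
  have x: "x \<ge> 1" using assms by (simp add: x_def)
  have "0 \<le> (1 + D) * ((2 * F + 1/2) + (1/2 - 2 * F) * x) + (- D) * x * ((3/2 - 2 * F) * x - (1/2 - 2 * F))"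
  proof (intro add_nonneg_nonneg[of "(1 + D) * _"] mult_nonneg_nonneg[of "1 + D"] mult_nonneg_nonneg[of "- D * x"])
    have "(3/2 - 2 * F) * x \<ge> (3/2 - 2 * F) * 1" using x F by (intro mult_left_mono) auto
    then show "0 \<le> (3/2 - 2 * F) * x - (1/2 - 2 * F)" by simp
    have "0 \<le> (1/2 - 2 * F) * x" using x F by (intro mult_nonneg_nonneg) auto
    then show "0 \<le> 2 * F + 1/2 + (1/2 - 2 * F) * x" using F by linarith
  qed (use x D_gt D_lt in \<open>auto simp: mult_nonpos_nonneg\<close>)
  then have "0 \<le> e\<^sup>2 * ((1 + D) * ((2 * F + 1/2) + (1/2 - 2 * F) * x) + (- D) * x * ((3/2 - 2 * F) * x - (1/2 - 2 * F)))"
    by (intro mult_nonneg_nonneg) auto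
  also have "\<dots> = z - dpot y / 2"
    unfolding z_def dpot_def frc_def e_def[symmetric] x_def[symmetric]
    by (simp add: field_simps power2_eq_square)
  finally show "dpot y / 2 \<le> z" by simp
qed

text \<open>By the previous bound the right side has derivative at least
  \<open>dpot y * (1 + exp (- y))\<close>. The factor \<open>1 - exp (- y)\<close> makes it vanish
  to second order at 0, as \<open>pot\<close> does.\<close>

lemma pot_le_dpot:
  assumes "y \<ge> 0" shows "pot y \<le> 2 * dpot y * (1 - exp (- y))"
proof -
  have "2 * dpot 0 * (1 - exp (- 0)) - pot 0 \<le> 2 * dpot y * (1 - exp (- y)) - pot y"
  proof (rule DERIV_nonneg_imp_nondecreasing[OF assms, where f = "\<lambda>y. 2 * dpot y * (1 - exp (- y)) - pot y"])
    fix t :: real assume t: "0 \<le> t"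
    from DERIV_dpot_ge[OF t] obtain z where z: "(dpot has_real_derivative z) (at t)" "dpot t / 2 \<le> z" by blast
    have "((\<lambda>y. 2 * dpot y * (1 - exp (- y)) - pot y) has_real_derivative
        2 * z * (1 - exp (- t)) + 2 * dpot t * exp (- t) - dpot t) (at t)"
      by (rule DERIV_cong[OF DERIV_diff[OF DERIV_mult[OF DERIV_cmult[OF z(1)]] DERIV_pot]])
        (auto intro!: derivative_eq_intros simp: dpot_def)
    moreover have "dpot t * (1 - exp (- t)) \<le> 2 * z * (1 - exp (- t))"
      using z t by (intro mult_right_mono) auto
    moreover have "0 \<le> dpot t * exp (- t)" using dpot_nonneg[OF t] by simp
    ultimately show "\<exists>w. ((\<lambda>y. 2 * dpot y * (1 - exp (- y)) - pot y) has_real_derivative w) (at t) \<and> 0 \<le> w"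
      by (intro exI[of _ "2 * z * (1 - exp (- t)) + 2 * dpot t * exp (- t) - dpot t"])
        (auto simp: algebra_simps)
  qed
  then show ?thesis by simp
qed

lemma dfrc_le: assumes "y \<ge> 0" shows "dfrc y \<le> 4 * exp y ^ 2"
proof -
  have F: "-1/8 \<le> F" "F \<le> 1/8" using F_le by auto
  define x where "x = exp y"
  have x: "x \<ge> 1" using assms by (simp add: x_def)
  then have x2: "x \<le> x\<^sup>2" "1 \<le> x\<^sup>2" by (auto simp: power2_eq_square mult_ge1_I)
  have "F * (1 + D) \<le> 1/8 * 1" using F D_gt D_lt by (intro mult_mono) auto
  moreover have "(1 - F) * (1 + 2 * D) * x \<le> (9/8 * 1) * x\<^sup>2"
  proof -
    have "(1 - F) * (1 + 2 * D) \<le> (1 - F) * 1" using F D_lt by (intro mult_left_mono) auto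
    also have "\<dots> \<le> 9/8 * 1" using F by simp
    finally have "(1 - F) * (1 + 2 * D) \<le> 9/8 * 1" .
    then have "(1 - F) * (1 + 2 * D) * x \<le> (9/8 * 1) * x" using x by (intro mult_right_mono) auto
    then show ?thesis using x2 by linarith
  qed
  moreover have "(2 - F) * (- D) * x\<^sup>2 \<le> (17/8 * 1) * x\<^sup>2"
    using F D_gt D_lt x by (intro mult_right_mono mult_mono) auto
  ultimately show ?thesis unfolding dfrc_def x_def[symmetric] using x2 by (simp add: algebra_simps)
qed

text \<open>Only \<open>- 2 * pot * dfrc\<close> can make \<open>psi\<close> negative. A further
  factor \<open>2 * pot\<close> pairs each \<open>exp y\<close> from the bound on
  \<open>dfrc\<close> with one \<open>pot\<close>; then
  \<open>pot * exp y \<le> 2 * dpot * (exp y - 1)\<close> yields the power \<open>frc ^ 3\<close> of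
  the denominator, and the extra factor becomes \<open>rad ^ 2\<close>.\<close>

lemma dspd_ge_right:
  assumes "d > 0" "d \<le> - D" "y > 0"
  shows "dspd y \<ge> - (64 / d) * exp (- F * y) / rad y ^ 2"
proof -
  define x where "x = exp y"
  have x: "x > 1" using assms by (simp add: x_def)
  have p: "pot y > 0" using assms pot_pos by auto
  have f: "frc y > 0" using assms by (simp add: frc_pos_iff)
  have dp: "dpot y \<ge> 0" using dpot_nonneg assms by simp
  have "pot y * x \<le> 2 * dpot y * (1 - exp (- y)) * x"
    using pot_le_dpot[of y] assms x by (intro mult_right_mono) auto
  also have "\<dots> = 2 * dpot y * (x - 1)" by (simp add: x_def exp_minus field_simps)
  finally have a: "pot y * x \<le> 2 * dpot y * (x - 1)" .
  have "(x - 1) * (x * d) \<le> (x - 1) * (1 + D - D * x)"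
    using x assms D_gt mult_left_mono[of d "- D" x] by (intro mult_left_mono) (auto simp: mult.commute)
  also have "\<dots> = exp (F * y) * frc y" by (simp add: frc_def x_def exp_minus field_simps)
  finally have b: "(x - 1) * (x * d) \<le> exp (F * y) * frc y" .
  have "(x - 1) * (x - 1) * d \<le> (x - 1) * (x * d)"
    using x assms by (simp add: mult_mono)
  with b have b': "(x - 1)\<^sup>2 * d \<le> exp (F * y) * frc y" by (simp add: power2_eq_square)
  have "- psi y * (2 * pot y) \<le> 2 * pot y * dfrc y * (2 * pot y)"
    using p by (intro mult_right_mono) (auto simp: psi_def)
  also have "\<dots> \<le> 2 * pot y * (4 * x\<^sup>2) * (2 * pot y)"
    using dfrc_le[of y] assms p by (intro mult_right_mono mult_left_mono) (auto simp: x_def)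
  also have "\<dots> = 16 * (pot y * x)\<^sup>2" by (simp add: power2_eq_square)
  also have "\<dots> \<le> 16 * (2 * dpot y * (x - 1))\<^sup>2"
    using a p x by (intro mult_left_mono power_mono) auto
  finally have "- psi y * (2 * pot y) \<le> 16 * (2 * dpot y * (x - 1))\<^sup>2" .
  then have "- psi y * (2 * pot y) * d \<le> 16 * (2 * dpot y * (x - 1))\<^sup>2 * d"
    by (rule mult_right_mono) (use assms in simp)
  also have "\<dots> = 64 * (dpot y)\<^sup>2 * ((x - 1)\<^sup>2 * d)" by (simp add: power2_eq_square)
  also have "\<dots> \<le> 64 * (dpot y)\<^sup>2 * (exp (F * y) * frc y)"
    by (intro mult_left_mono b') auto
  also have "\<dots> = 64 * exp (- F * y) * frc y ^ 3"
    by (simp add: dpot_def power2_eq_square power3_eq_cube exp_minus field_simps)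
  finally have "- psi y * (2 * pot y) * d \<le> 64 * exp (- F * y) * frc y ^ 3" .
  then have "- psi y * (2 * pot y) * d / (2 * pot y * d * frc y ^ 3)
      \<le> 64 * exp (- F * y) * frc y ^ 3 / (2 * pot y * d * frc y ^ 3)"
    by (rule divide_right_mono) (use assms p f in simp)
  moreover have "- psi y * (2 * pot y) * d / (2 * pot y * d * frc y ^ 3) = - dspd y"
    using assms p f by (simp add: dspd_def)
  moreover have "64 * exp (- F * y) * frc y ^ 3 / (2 * pot y * d * frc y ^ 3)
      = (64 / d) * exp (- F * y) / (2 * pot y)"
    using assms p f by simp
  ultimately show ?thesis unfolding rad_sq by linarith
qed

text \<open>Allows the weight \<open>exp (- F * a)\<close> at an inner point to be replaced by the
  one at the turning point, at the cost of a ratio of radii. The derivative is nonnegative because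
  \<open>F * rad ^ 2 \<le> dpot\<close>.\<close>

lemma exp_rad_mono:
  assumes "0 < a" "a \<le> b"
  shows "exp (- F * a) * rad a \<le> exp (- F * b) * rad b"
proof (rule DERIV_nonneg_imp_nondecreasing[OF assms(2), where f = "\<lambda>y. exp (- F * y) * rad y"])
  fix t assume "a \<le> t"
  then have t: "t > 0" using assms by simp
  have "((\<lambda>y. exp (- F * y) * rad y) has_real_derivative
      exp (- F * t) * (exp (- F * t) / spd t - F * rad t)) (at t)"
    by (auto intro!: derivative_eq_intros DERIV_rad simp: algebra_simps)
  moreover have "F * rad t \<le> exp (- F * t) / spd t"
  proof -
    have "dpot t * (1 - exp (- t)) \<le> dpot t * 1"
      using dpot_nonneg[of t] t by (intro mult_left_mono) auto
    then have pd: "pot t \<le> 2 * dpot t" using pot_le_dpot[of t] t by simp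
    have "F * rad t ^ 2 \<le> 1/8 * rad t ^ 2" using F_le by (intro mult_right_mono) auto
    also have "\<dots> \<le> dpot t" using pd dpot_nonneg[of t] t by (simp add: rad_sq)
    finally show ?thesis using t rad_pos[of t] frc_pos_iff[of t]
      by (simp add: spd_def dpot_def divide_simps power2_eq_square algebra_simps)
  qed
  ultimately show "\<exists>w. ((\<lambda>y. exp (- F * y) * rad y) has_real_derivative w) (at t) \<and> 0 \<le> w"
    by (intro exI[of _ "exp (- F * t) * (exp (- F * t) / spd t - F * rad t)"] conjI) auto
qed

text \<open>At a left turning point the left side is \<open>R * lag (- R)\<close>. There
  \<open>2 * pot\<close> and \<open>2 * g * lin_part\<close> differ by \<open>rest_part\<close> and
  a bounded multiple of \<open>lin_part * exp y\<close>, within 12 in all, and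
  \<open>y \<le> - ln 2\<close> gives \<open>g \<ge> d / 2\<close>.\<close>

lemma pot_over_frc_left:
  assumes "d > 0" "d \<le> 1 + D" "y \<le> - ln 2"
  shows "- (2 * pot y) / frc y \<ge> exp (F * y) * (2 * lin_part y - 24 / d)"
proof -
  define x where "x = exp y"
  define g where "g = (1 - x) * (1 + D - D * x)"
  have "exp y \<le> exp (- ln 2)" using assms by simp
  then have x: "0 < x" "x \<le> 1/2" by (auto simp: x_def exp_minus)
  have "- (y::real) > 0" using assms(3) ln_gt_zero[of "2::real"] by linarith
  then have y: "y < 0" by simp
  have "(1/2) * d \<le> g"
    unfolding g_def using assms x D_lt mult_neg_pos[OF D_lt x(1)] by (intro mult_mono) auto
  then have gd: "g \<ge> d / 2" "g > 0" using assms by auto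
  have "frc y = - (g / exp (F * y))" by (simp add: frc_def g_def x_def exp_minus divide_simps algebra_simps)
  then have quot: "- (2 * pot y) / frc y = exp (F * y) * (2 * pot y / g)"
    using gd by simp
  have "lin_part y * x \<le> 2"
  proof -
    have "- y \<le> 2 * exp (- (3 * y / 4))" using exp_ge_add_one_self[of "- (3 * y / 4)"] y by linarith
    then have "- y * exp (3 * y / 4) \<le> 2 * exp (- (3 * y / 4)) * exp (3 * y / 4)"
      by (intro mult_right_mono) auto
    also have "\<dots> = 2" by (simp add: exp_minus)
    finally show ?thesis using lin_part_exp_abs[of y] y by (simp add: x_def)
  qed
  moreover have "lin_part y * x \<ge> 0" using lin_part_nonneg[of y] x y by simp
  moreover have "- (1 + 2 * D) + D * x \<le> 1"
    using D_gt D_lt mult_neg_pos[OF D_lt x(1)] by linarith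
  ultimately have "2 * (lin_part y * x) * (- (1 + 2 * D) + D * x) \<le> 2 * (lin_part y * x) * 1"
    by (intro mult_left_mono) auto
  then have "2 * (lin_part y * x) * (- (1 + 2 * D) + D * x) \<le> 4" using \<open>lin_part y * x \<le> 2\<close> by linarith
  moreover have "2 * g * lin_part y = 2 * (1 + D) * lin_part y + 2 * (lin_part y * x) * (- (1 + 2 * D) + D * x)"
    by (simp add: g_def algebra_simps)
  moreover have "rest_part y \<ge> - 4" using rest_part_bound[of y] y by simp
  ultimately have "2 * pot y \<ge> 2 * g * lin_part y - 12" unfolding pot_split by linarith
  then have "2 * pot y / g \<ge> (2 * g * lin_part y - 12) / g" using gd by (intro divide_right_mono) auto
  also have "(2 * g * lin_part y - 12) / g = 2 * lin_part y - 12 / g" using gd by (simp add: field_simps)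
  finally have "2 * pot y / g \<ge> 2 * lin_part y - 12 / g" .
  moreover have "12 / g \<le> 24 / d" using gd assms by (simp add: divide_simps)
  ultimately show ?thesis unfolding quot by (intro mult_left_mono) auto
qed

section \<open>Comparison of the two turning points\<close>

lemma pot_right_ge:
  assumes "d > 0" "d \<le> - D" "y \<ge> 0"
  shows "pot y \<ge> d * (exp y - 1 - y)"
proof -
  have "pot 0 - d * (exp 0 - 1 - 0) \<le> pot y - d * (exp y - 1 - y)"
  proof (rule DERIV_nonneg_imp_nondecreasing[OF assms(3), where f = "\<lambda>y. pot y - d * (exp y - 1 - y)"])
    fix t :: real assume t: "0 \<le> t"
    have "((\<lambda>y. pot y - d * (exp y - 1 - y)) has_real_derivative
      exp (- F * t) * frc t - d * (exp t - 1)) (at t)"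
      by (auto intro!: derivative_eq_intros DERIV_pot)
    moreover have "d * (exp t - 1) \<le> exp (- F * t) * frc t"
    proof -
      have "2 * F \<le> 1" using F_le by linarith
      then have "2 * F * t \<le> t" using t mult_right_mono[of "2*F" 1 t] by simp
      then have "exp (- F * t) * exp (- F * t) * exp t \<ge> 1"
        by (simp flip: exp_add)
      then have "d * (exp t - 1) * 1 \<le> d * (exp t - 1) * (exp (- F * t) * exp (- F * t) * exp t)"
        using t assms by (intro mult_left_mono) auto
      also have "\<dots> = exp (- F * t) * exp (- F * t) * (exp t - 1) * (d * exp t)" by simp
      also have "\<dots> \<le> exp (- F * t) * exp (- F * t) * (exp t - 1) * (1 + D - D * exp t)"
        using t assms D_gt mult_right_mono[of d "- D" "exp t"] by (intro mult_left_mono) auto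
      also have "\<dots> = exp (- F * t) * frc t" by (simp add: frc_def)
      finally show ?thesis by simp
    qed
    ultimately show "\<exists>w. ((\<lambda>y. pot y - d * (exp y - 1 - y)) has_real_derivative w) (at t) \<and> 0 \<le> w"
      by (intro exI[of _ "exp (- F * t) * frc t - d * (exp t - 1)"] conjI) auto
  qed
  then show ?thesis by simp
qed

lemma pot_left_le:
  assumes "y \<le> 0" shows "pot y \<le> - y * exp (- y / 4) + 2"
proof -
  have "(1 + D) * lin_part y \<le> 1 * lin_part y"
    using lin_part_nonneg[OF assms] D_lt by (intro mult_right_mono) auto
  then show ?thesis
    using pot_split[of y] lin_part_abs[OF assms] rest_part_bound[OF assms] by linarith
qed

end

text \<open>The potential grows at least like \<open>d * exp y\<close> on the right but at most like
  \<open>- y * exp (- y / 4)\<close> on the left. Neither bound involves \<open>D\<close> or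
  \<open>F\<close>, so one \<open>Y\<close> serves all parameters.\<close>

lemma turning_points_gap:
  fixes d Z :: real
  assumes "d > 0" "Z \<ge> 0"
  obtains Y where "Y \<ge> ln 2" and
    "\<And>D F ym yp. loud_field D F \<Longrightarrow> d \<le> - D \<Longrightarrow> ym \<le> - Y \<Longrightarrow> yp \<ge> 0 \<Longrightarrow>
       loud_field.pot D F yp = loud_field.pot D F ym \<Longrightarrow> yp + Z \<le> - ym"
proof -
  have "eventually (\<lambda>Y. Y * exp (Y / 4) + 2 < d * (exp (Y - Z) - 1 - (Y - Z))) at_top"
    using assms by real_asymp
  then obtain Y0 where Y0: "\<And>Y. Y \<ge> Y0 \<Longrightarrow> Y * exp (Y / 4) + 2 < d * (exp (Y - Z) - 1 - (Y - Z))"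
    unfolding eventually_at_top_linorder by blast
  show ?thesis
  \<comment> \<open>\<open>Z\<close> makes \<open>- ym - Z\<close> nonnegative, as
    \<open>pot_right_ge\<close> requires; \<open>ln 2\<close> is the threshold of
    \<open>pot_over_frc_left\<close>.\<close>
  proof (rule that[of "max Y0 (max Z (ln 2))"])
    fix D F ym yp
    assume L: "loud_field D F" and a: "d \<le> - D" "ym \<le> - max Y0 (max Z (ln 2))" "yp \<ge> 0"
      and e: "loud_field.pot D F yp = loud_field.pot D F ym"
    interpret loud_field D F by (rule L)
    have ym: "- ym \<ge> Y0" "- ym \<ge> Z" "ym \<le> 0" using a assms by auto
    show "yp + Z \<le> - ym"
    proof (rule ccontr)
      assume "\<not> yp + Z \<le> - ym"
      then have "pot (- ym - Z) < pot yp" using ym by (intro pot_strict_mono) auto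
      moreover have "pot (- ym - Z) \<ge> d * (exp (- ym - Z) - 1 - (- ym - Z))"
        using ym assms a by (intro pot_right_ge) auto
      moreover have "pot ym \<le> - ym * exp (- ym / 4) + 2" using ym by (intro pot_left_le)
      ultimately show False using Y0[of "- ym"] ym e by simp
    qed
  qed auto
qed

section \<open>The derivative of the period integral\<close>

context loud_field
begin

text \<open>\<open>lag\<close> and \<open>dlag\<close> are \<open>K\<close> and \<open>dK/dr\<close> as functions of \<open>r\<close>. For \<open>F < 0\<close> the range of \<open>rad\<close> is a
  proper subset of the reals, and \<open>rad_inv\<close> is meaningless outside it.\<close>

lemma isCont_rad: "isCont rad y"
  using DERIV_rad DERIV_isCont by blast

lemma rad_strict_mono: "a < b \<Longrightarrow> rad a < rad b"
  by (rule DERIV_pos_imp_increasing) (use DERIV_rad spd_pos in force)+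

lemma rad_less_iff [simp]: "rad a < rad b \<longleftrightarrow> a < b"
  using rad_strict_mono by (metis less_asym linorder_neqE_linordered_idom)

lemma rad_le_iff [simp]: "rad a \<le> rad b \<longleftrightarrow> a \<le> b"
  using rad_less_iff by (meson not_le)

lemma rad_eq_iff [simp]: "rad a = rad b \<longleftrightarrow> a = b"
  by (simp add: order_eq_iff)

definition rad_inv :: "real \<Rightarrow> real" where "rad_inv = inv rad"

lemma rad_inv_rad [simp]: "rad_inv (rad y) = y"
  unfolding rad_inv_def by (simp add: inv_f_f inj_def)

lemma rad_inv_0 [simp]: "rad_inv 0 = 0"
  using rad_inv_rad[of 0] by simp

lemma rad_rad_inv [simp]: "\<rho> \<in> range rad \<Longrightarrow> rad (rad_inv \<rho>) = \<rho>"
  by auto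

lemma range_rad_between:
  assumes "a \<in> range rad" "b \<in> range rad" "a \<le> c" "c \<le> b" shows "c \<in> range rad"
proof -
  from assms obtain s t where st: "a = rad s" "b = rad t" by blast
  with assms have "s \<le> t" using rad_le_iff[of s t] by linarith
  then obtain z where "rad z = c"
    using IVT[of rad s c t] isCont_rad assms(3,4) unfolding st by blast
  then show ?thesis by blast
qed

lemma isCont_rad_inv: "\<rho> \<in> range rad \<Longrightarrow> isCont rad_inv \<rho>"
  using isCont_inverse_function[of 1 _ rad_inv rad] isCont_rad by auto

lemma DERIV_rad_inv:
  assumes "\<rho> \<in> range rad"
  shows "(rad_inv has_real_derivative spd (rad_inv \<rho>) * exp (F * rad_inv \<rho>)) (at \<rho>)"
proof -
  define y where "y = rad_inv \<rho>"
  have r: "rad y = \<rho>" using assms by (auto simp: y_def)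
  have "(rad_inv has_real_derivative inverse (exp (- F * y) / spd y)) (at \<rho>)"
  proof (rule DERIV_inverse_function[where f = rad and a = "rad (y - 1)" and b = "rad (y + 1)"])
    show "(rad has_real_derivative exp (- F * y) / spd y) (at (rad_inv \<rho>))"
      unfolding y_def by (rule DERIV_rad)
    show "exp (- F * y) / spd y \<noteq> 0" using spd_pos[of y] by simp
    show "rad (y - 1) < \<rho>" "\<rho> < rad (y + 1)" unfolding r[symmetric] by auto
    show "rad (rad_inv z) = z" if "rad (y - 1) < z" "z < rad (y + 1)" for z
      by (rule rad_rad_inv, rule range_rad_between[of "rad (y - 1)" "rad (y + 1)"]) (use that in auto)
  qed (rule isCont_rad_inv[OF assms])
  then show ?thesis by (simp add: y_def exp_minus field_simps)
qed

section \<open>\<open>K\<close> as a function of \<open>r\<close>, and the period integral\<close>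

definition lag :: "real \<Rightarrow> real" where "lag \<rho> = spd (rad_inv \<rho>)"
definition dlag :: "real \<Rightarrow> real" where "dlag \<rho> = dspd (rad_inv \<rho>)"

lemma lag_pos: "lag \<rho> > 0" by (simp add: lag_def spd_pos)

lemma DERIV_lag:
  assumes "\<rho> \<in> range rad" shows "(lag has_real_derivative dlag \<rho>) (at \<rho>)"
proof -
  have "(lag has_real_derivative dspd (rad_inv \<rho>) * (exp (- F * rad_inv \<rho>) / spd (rad_inv \<rho>))
      * (spd (rad_inv \<rho>) * exp (F * rad_inv \<rho>))) (at \<rho>)"
    unfolding lag_def by (rule DERIV_chain2[OF DERIV_spd DERIV_rad_inv[OF assms]])
  then show ?thesis using spd_pos[of "rad_inv \<rho>"] by (simp add: dlag_def exp_minus)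
qed

lemma isCont_lag: "\<rho> \<in> range rad \<Longrightarrow> isCont lag \<rho>"
  using DERIV_lag DERIV_isCont by blast

lemma isCont_dlag: "\<rho> \<in> range rad \<Longrightarrow> isCont dlag \<rho>"
  unfolding dlag_def by (rule isCont_o2[OF isCont_rad_inv isCont_dspd])

lemma continuous_on_lag: "continuous_on (range rad) lag"
  by (simp add: continuous_at_imp_continuous_on isCont_lag)

lemma continuous_on_dlag: "continuous_on (range rad) dlag"
  by (simp add: continuous_at_imp_continuous_on isCont_dlag)

text \<open>The time in which \<open>\<theta>\<close> runs over \<open>[0, pi]\<close>, with
  \<open>\<theta>\<close> and \<open>pi - \<theta>\<close> folded together.\<close>

definition half_period :: "real \<Rightarrow> real" where
  "half_period R = integral {0..pi/2} (\<lambda>\<theta>. lag (R * cos \<theta>) + lag (- (R * cos \<theta>)))"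

definition dhalf_period :: "real \<Rightarrow> real" where
  "dhalf_period R = integral {0..pi/2} (\<lambda>\<theta>. cos \<theta> * (dlag (R * cos \<theta>) - dlag (- (R * cos \<theta>))))"

lemma range_rad_cos:
  assumes "R \<in> range rad" "- R \<in> range rad"
  shows "R * cos \<theta> \<in> range rad" "- (R * cos \<theta>) \<in> range rad"
proof -
  have "\<bar>R * cos \<theta>\<bar> \<le> \<bar>R\<bar> * 1" unfolding abs_mult by (intro mult_left_mono abs_cos_le_one) auto
  then have b: "\<bar>R * cos \<theta>\<bar> \<le> \<bar>R\<bar>" by simp
  have *: "- \<bar>R\<bar> \<in> range rad" "\<bar>R\<bar> \<in> range rad" using assms by (auto simp: abs_if)
  show "R * cos \<theta> \<in> range rad" "- (R * cos \<theta>) \<in> range rad"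
    using b by (intro range_rad_between[OF *]; simp)+
qed

text \<open>The range of \<open>rad\<close> is an open interval, so \<open>R\<close> and
  \<open>- R\<close> can be moved outwards together; this gives the Leibniz rule a neighbourhood of
  \<open>R\<close>.\<close>

lemma range_rad_nbhd:
  assumes "R \<in> range rad" "- R \<in> range rad" "R > 0"
  obtains B where "B > R" "B \<in> range rad" "- B \<in> range rad"
proof -
  from assms obtain s t where st: "R = rad s" "- R = rad t" by blast
  define B where "B = min (rad (s + 1)) (- rad (t - 1))"
  have "rad (s + 1) > R" "- rad (t - 1) > R"
    using st rad_strict_mono[of s "s+1"] rad_strict_mono[of "t-1" t] by linarith+
  then have "B > R" by (simp add: B_def)
  moreover have "B \<in> range rad"
    by (rule range_rad_between[OF assms(1), of "rad (s + 1)"]) (use \<open>B > R\<close> in \<open>auto simp: B_def\<close>)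
  moreover have "- B \<in> range rad"
    by (rule range_rad_between[OF _ assms(2), of "rad (t - 1)"]) (use \<open>B > R\<close> in \<open>auto simp: B_def\<close>)
  ultimately show ?thesis by (rule that)
qed

lemma DERIV_half_period:
  assumes "R \<in> range rad" "- R \<in> range rad" "R > 0"
  shows "(half_period has_real_derivative dhalf_period R) (at R)"
proof -
  obtain B where B: "B > R" "B \<in> range rad" "- B \<in> range rad"
    using range_rad_nbhd[OF assms] .
  define V where "V = {-B..B}"
  have inr: "x * cos t \<in> range rad" "- (x * cos t) \<in> range rad" if "x \<in> V" for x t
  proof -
    have "x \<in> range rad" "- x \<in> range rad"
      using that B range_rad_between[OF B(3,2)] by (auto simp: V_def)
    then show "x * cos t \<in> range rad" "- (x * cos t) \<in> range rad" by (rule range_rad_cos)+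
  qed
  have "((\<lambda>x. integral (cbox 0 (pi/2)) (\<lambda>\<theta>. lag (x * cos \<theta>) + lag (- (x * cos \<theta>))))
      has_field_derivative integral (cbox 0 (pi/2)) (\<lambda>\<theta>. cos \<theta> * (dlag (R * cos \<theta>) - dlag (- (R * cos \<theta>)))))
      (at R within V)"
  proof (rule leibniz_rule_field_derivative[where U = V])
    fix x t assume x: "x \<in> V" and t: "t \<in> cbox 0 (pi/2)"
    have "((\<lambda>x. lag (x * cos t)) has_real_derivative dlag (x * cos t) * cos t) (at x)"
      by (rule DERIV_chain2[where g = "\<lambda>x. x * cos t"])
        (auto intro!: derivative_eq_intros DERIV_lag inr x)
    moreover have "((\<lambda>x. lag (- (x * cos t))) has_real_derivative dlag (- (x * cos t)) * (- cos t)) (at x)"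
      by (rule DERIV_chain2[where g = "\<lambda>x. - (x * cos t)"])
        (auto intro!: derivative_eq_intros DERIV_lag inr x)
    ultimately have "((\<lambda>x. lag (x * cos t) + lag (- (x * cos t))) has_real_derivative
        dlag (x * cos t) * cos t + dlag (- (x * cos t)) * (- cos t)) (at x)"
      by (rule DERIV_add)
    then show "((\<lambda>x. lag (x * cos t) + lag (- (x * cos t))) has_real_derivative
        cos t * (dlag (x * cos t) - dlag (- (x * cos t)))) (at x within V)"
      by (simp add: algebra_simps has_field_derivative_at_within)
  next
    fix x assume x: "x \<in> V"
    have "continuous_on (cbox 0 (pi/2)) (\<lambda>t. lag (x * cos t) + lag (- (x * cos t)))"
      by (intro continuous_intros continuous_on_compose2[OF continuous_on_lag]) (use inr[OF x] in auto)
    then show "(\<lambda>t. lag (x * cos t) + lag (- (x * cos t))) integrable_on cbox 0 (pi/2)"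
      by (rule integrable_continuous)
  next
    note c = continuous_on_compose2[OF continuous_on_dlag]
    show "continuous_on (V \<times> cbox 0 (pi/2)) (\<lambda>(x, t). cos t * (dlag (x * cos t) - dlag (- (x * cos t))))"
      unfolding split_beta by (intro continuous_intros c) (use inr in auto)
  qed (use B assms in \<open>auto simp: V_def\<close>)
  moreover have "at R within V = at R"
    by (rule at_within_interior) (use B assms in \<open>simp add: V_def\<close>)
  ultimately show ?thesis
    unfolding half_period_def[abs_def] dhalf_period_def by (simp only: cbox_interval)
qed

text \<open>The constant \<open>320 / d\<close> only has to exceed \<open>2 * (24 / d + 128 / d)\<close>, where \<open>24 / d\<close> bounds the error in
  the evaluation of \<open>\<Phi> R\<close> and \<open>128 / d\<close> the error from replacing the weight.\<close>
lemma dhalf_period_pos: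
  assumes d: "d > 0" "d \<le> - D" "d \<le> 1 + D" "\<bar>F\<bar> \<le> d / 8"
    and Z: "Z = 320 / d" "\<bar>F\<bar> * Z \<le> 1/2"
    and y: "rad yp = R" "rad ym = - R" "yp > 0" "ym \<le> - ln 2" "yp + Z \<le> - ym"
  shows "dhalf_period R > 0"
proof -
  have R: "R > 0" using y rad_pos by auto
  have rg: "R \<in> range rad" "- R \<in> range rad" using y by (metis rangeI)+
  note rc = range_rad_cos[OF rg]
  define s where "s = exp (- F * yp)"
  define q where "q = exp_prim (- F)"
  \<comment> \<open>Since \<open>q (rad_inv \<rho>)\<close> has derivative
    \<open>lag \<rho>\<close>, subtracting the \<open>q\<close> terms leaves exactly
    \<open>\<rho> * k' \<rho>\<close> as derivative.\<close>
  define \<Phi> where "\<Phi> \<rho> = \<rho> * (lag \<rho> + lag (- \<rho>)) - (q (rad_inv \<rho>) - q (rad_inv (- \<rho>)))" for \<rho>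
  define k' where "k' \<rho> = dlag \<rho> - dlag (- \<rho>)" for \<rho>
  define h where "h \<theta> = R\<^sup>2 * cos \<theta> * k' (R * cos \<theta>)" for \<theta>
  have Dq: "((\<lambda>\<rho>. q (rad_inv \<rho>)) has_real_derivative lag \<rho>) (at \<rho>)" if "\<rho> \<in> range rad" for \<rho>
  proof -
    have "((\<lambda>\<rho>. q (rad_inv \<rho>)) has_real_derivative
        exp (- F * rad_inv \<rho>) * (spd (rad_inv \<rho>) * exp (F * rad_inv \<rho>))) (at \<rho>)"
      unfolding q_def by (rule DERIV_chain2[OF DERIV_exp_prim DERIV_rad_inv[OF that]])
    then show ?thesis by (simp add: lag_def exp_minus field_simps)
  qed
  have D\<Phi>: "(\<Phi> has_real_derivative \<rho> * k' \<rho>) (at \<rho>)" if r: "\<rho> \<in> range rad" "- \<rho> \<in> range rad" for \<rho>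
  proof -
    have m: "((\<lambda>\<rho>::real. - \<rho>) has_real_derivative -1) (at \<rho>)" by (auto intro!: derivative_eq_intros)
    have a: "((\<lambda>\<rho>. lag (- \<rho>)) has_real_derivative dlag (- \<rho>) * -1) (at \<rho>)"
      by (rule DERIV_chain2[where g = uminus, OF DERIV_lag[OF r(2)] m])
    have b: "((\<lambda>\<rho>. q (rad_inv (- \<rho>))) has_real_derivative lag (- \<rho>) * -1) (at \<rho>)"
      by (rule DERIV_chain2[where g = uminus, OF Dq[OF r(2)] m])
    have "(\<Phi> has_real_derivative (1 * (lag \<rho> + lag (- \<rho>)) + (dlag \<rho> + dlag (- \<rho>) * -1) * \<rho>)
        - (lag \<rho> - lag (- \<rho>) * -1)) (at \<rho>)"
      unfolding \<Phi>_def
      by (intro DERIV_diff DERIV_mult DERIV_add DERIV_ident DERIV_lag Dq a b r)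
    then show ?thesis by (simp add: k'_def algebra_simps)
  qed
  have ch: "continuous_on {0..pi/2} h"
    unfolding h_def k'_def
    by (intro continuous_intros continuous_on_compose2[OF continuous_on_dlag]) (use rc in auto)
  \<comment> \<open>The extra \<open>sin \<theta>\<close> completes the chain rule for
    \<open>\<Phi> (R * cos \<theta>)\<close>; the end \<open>pi/2\<close> contributes
    \<open>\<Phi> 0 = 0\<close>.\<close>
  have i1: "((\<lambda>\<theta>. h \<theta> * sin \<theta>) has_integral - \<Phi> (R * cos (pi/2)) - (- \<Phi> (R * cos 0))) {0..pi/2}"
  proof (rule fundamental_theorem_of_calculus[where f = "\<lambda>\<theta>. - \<Phi> (R * cos \<theta>)"])
    fix \<theta> :: real
    have "((\<lambda>\<theta>. \<Phi> (R * cos \<theta>)) has_real_derivative (R * cos \<theta> * k' (R * cos \<theta>)) * (- (R * sin \<theta>))) (at \<theta>)"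
      by (rule DERIV_chain2[where g = "\<lambda>\<theta>. R * cos \<theta>", OF D\<Phi>[OF rc]])
        (auto intro!: derivative_eq_intros)
    from DERIV_minus[OF this] have "((\<lambda>\<theta>. - \<Phi> (R * cos \<theta>)) has_real_derivative h \<theta> * sin \<theta>) (at \<theta>)"
      by (rule DERIV_cong) (simp add: h_def power2_eq_square)
    then show "((\<lambda>\<theta>. - \<Phi> (R * cos \<theta>)) has_vector_derivative h \<theta> * sin \<theta>) (at \<theta> within {0..pi/2})"
      unfolding has_real_derivative_iff_has_vector_derivative by (rule has_vector_derivative_at_within)
  qed simp
  have i1': "((\<lambda>\<theta>. h \<theta> * sin \<theta>) has_integral \<Phi> R) {0..pi/2}"
    using i1 by (simp add: \<Phi>_def)
  \<comment> \<open>The left side \<open>- \<rho>\<close> contributes with the good sign. Moving the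
    weight from \<open>a\<close> to \<open>yp\<close> costs \<open>R / \<rho>\<close>, hence the
    third power.\<close>
  have k'_ge: "k' \<rho> \<ge> - (64 / d) * s * R / \<rho> ^ 3" if \<rho>: "0 < \<rho>" "\<rho> \<le> R" for \<rho>
  proof -
    have r: "\<rho> \<in> range rad" "- \<rho> \<in> range rad"
      using \<rho> R range_rad_between[OF rg(2,1)] by auto
    define a where "a = rad_inv \<rho>"
    have ra: "rad a = \<rho>" using r by (simp add: a_def)
    have a0: "a > 0" using ra \<rho> rad_less_iff[of 0 a] by simp
    have ap: "a \<le> yp" using ra \<rho> y rad_le_iff[of a yp] by simp
    have "rad (rad_inv (- \<rho>)) < rad 0" using r \<rho> by simp
    then have "rad_inv (- \<rho>) < 0" by (simp only: rad_less_iff)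
    then have neg: "dlag (- \<rho>) \<le> 0" unfolding dlag_def using d by (intro dspd_nonpos_left[of d]) auto
    have "dlag \<rho> \<ge> - (64 / d) * exp (- F * a) / \<rho>\<^sup>2"
      using dspd_ge_right[OF d(1,2) a0] by (simp add: dlag_def ra flip: a_def)
    moreover have "exp (- F * a) \<le> s * R / \<rho>"
      using exp_rad_mono[OF a0 ap] \<rho> by (simp add: ra y s_def field_simps)
    then have "(64 / d) * exp (- F * a) / \<rho>\<^sup>2 \<le> (64 / d) * (s * R / \<rho>) / \<rho>\<^sup>2"
      using d by (intro divide_right_mono mult_left_mono) auto
    ultimately show ?thesis using neg by (simp add: k'_def power3_eq_cube power2_eq_square)
  qed
  \<comment> \<open>The bound on \<open>k'\<close> leaves the singular factor
    \<open>1 / cos \<theta> ^ 2\<close>, which \<open>1 - sin \<theta>\<close> compensates: their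
    product is \<open>1 / (1 + sin \<theta>)\<close>.\<close>
  have i2: "h \<theta> * (1 - sin \<theta>) \<ge> - ((64 / d) * s)" if \<theta>: "\<theta> \<in> {0..pi/2}" for \<theta>
  proof (cases "cos \<theta> = 0")
    case True
    then show ?thesis using d by (simp add: h_def s_def)
  next
    case False
    have c: "cos \<theta> > 0" using \<theta> False cos_ge_zero[of \<theta>] by auto
    have sn: "sin \<theta> \<ge> 0" using \<theta> by (intro sin_ge_zero) auto
    have "R * cos \<theta> \<le> R * 1" using R by (intro mult_left_mono) auto
    then have "k' (R * cos \<theta>) \<ge> - (64 / d) * s * R / (R * cos \<theta>) ^ 3"
      using R c by (intro k'_ge) auto
    then have "h \<theta> * (1 - sin \<theta>) \<ge> (R\<^sup>2 * cos \<theta> * (- (64 / d) * s * R / (R * cos \<theta>) ^ 3)) * (1 - sin \<theta>)"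
      unfolding h_def using c by (intro mult_right_mono mult_left_mono) auto
    also have "(R\<^sup>2 * cos \<theta> * (- (64 / d) * s * R / (R * cos \<theta>) ^ 3)) * (1 - sin \<theta>)
        = - ((64 / d) * s) * ((1 - sin \<theta>) / (cos \<theta>)\<^sup>2)"
      using R c d by (simp add: divide_simps power2_eq_square power3_eq_cube)
    finally have 1: "h \<theta> * (1 - sin \<theta>) \<ge> - ((64 / d) * s) * ((1 - sin \<theta>) / (cos \<theta>)\<^sup>2)" .
    have "(cos \<theta>)\<^sup>2 = (1 - sin \<theta>) * (1 + sin \<theta>)"
      using sin_cos_squared_add[of \<theta>] by (simp add: algebra_simps power2_eq_square)
    then have "1 - sin \<theta> \<le> (cos \<theta>)\<^sup>2"
      using sn mult_left_mono[of 1 "1 + sin \<theta>" "1 - sin \<theta>"] by simp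
    then have "(1 - sin \<theta>) / (cos \<theta>)\<^sup>2 \<le> 1" using c by simp
    then have "((64 / d) * s) * ((1 - sin \<theta>) / (cos \<theta>)\<^sup>2) \<le> ((64 / d) * s) * 1"
      using d by (intro mult_left_mono) (auto simp: s_def)
    then show ?thesis using 1 by simp
  qed
  have int: "(\<lambda>\<theta>. h \<theta> * (1 - sin \<theta>)) integrable_on {0..pi/2}"
    by (intro integrable_continuous_interval continuous_intros ch)
  have "integral {0..pi/2} (\<lambda>\<theta>. - ((64 / d) * s)) \<le> integral {0..pi/2} (\<lambda>\<theta>. h \<theta> * (1 - sin \<theta>))"
    by (rule integral_le[OF _ int i2]) auto
  then have "integral {0..pi/2} (\<lambda>\<theta>. h \<theta> * (1 - sin \<theta>)) \<ge> - ((64 / d) * s) * (pi/2)" by simp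
  moreover have "((64 / d) * s) * (pi/2) \<le> ((64 / d) * s) * 2"
    using d pi_half_le_two by (intro mult_left_mono) (auto simp: s_def)
  ultimately have i3: "integral {0..pi/2} (\<lambda>\<theta>. h \<theta> * (1 - sin \<theta>)) \<ge> - (128 / d) * s" by simp
  have "R\<^sup>2 * dhalf_period R = integral {0..pi/2} (\<lambda>\<theta>. h \<theta> * sin \<theta> + h \<theta> * (1 - sin \<theta>))"
    unfolding dhalf_period_def integral_mult_right[symmetric]
    by (intro integral_cong) (simp add: h_def k'_def algebra_simps)
  also have "\<dots> = \<Phi> R + integral {0..pi/2} (\<lambda>\<theta>. h \<theta> * (1 - sin \<theta>))"
    using i1' int by (subst integral_add) (auto simp: integral_unique has_integral_integrable)
  finally have main: "R\<^sup>2 * dhalf_period R \<ge> \<Phi> R - (128 / d) * s" using i3 by simp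
  have yi: "rad_inv R = yp" "rad_inv (- R) = ym" using y by (metis rad_inv_rad)+
  have ym0: "ym < 0" using y ln_gt_zero[of "2::real"] by linarith
  \<comment> \<open>\<open>M\<close> dominates the error weights \<open>exp (- F * yp)\<close> and
    \<open>exp (F * ym)\<close> at both turning points and also measures the gain, so the sign of
    \<open>F\<close> need not be distinguished.\<close>
  define M where "M = max (exp (- F * yp)) (exp (- F * - ym))"
  have "R * lag R \<ge> 0" using R lag_pos[of R] by simp
  moreover have "R * lag (- R) \<ge> exp (F * ym) * (2 * lin_part ym - 24 / d)"
  proof -
    have "R * lag (- R) = - (rad ym ^ 2 / frc ym)"
      using ym0 by (simp add: lag_def yi spd_def y power2_eq_square)
    also have "\<dots> = - (2 * pot ym) / frc ym" by (simp add: rad_sq)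
    finally show ?thesis using pot_over_frc_left[OF d(1,3) y(4)] by simp
  qed
  moreover have "exp (F * ym) * (2 * lin_part ym - 24 / d) + q ym = q (- ym) - 24 / d * exp (F * ym)"
    using exp_prim_identity[of F ym] by (simp add: lin_part_def q_def algebra_simps)
  ultimately have "\<Phi> R \<ge> q (- ym) - q yp - 24 / d * exp (F * ym)"
    unfolding \<Phi>_def yi by (simp add: algebra_simps)
  moreover have "q (- ym) - q yp \<ge> Z / 2 * M"
    unfolding q_def M_def using d Z by (intro exp_prim_diff_ge y) auto
  moreover have "24 / d * exp (F * ym) \<le> 24 / d * M" "(128 / d) * s \<le> (128 / d) * M"
    using d by (auto simp: M_def s_def intro!: mult_left_mono divide_right_mono)
  ultimately have "R\<^sup>2 * dhalf_period R \<ge> Z / 2 * M - 24 / d * M - 128 / d * M"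
    using main by linarith
  also have "Z / 2 * M - 24 / d * M - 128 / d * M = 8 / d * M" using d Z by (simp add: field_simps)
  finally have "R\<^sup>2 * dhalf_period R \<ge> 8 / d * M" .
  moreover have "8 / d * M > 0" using d by (simp add: M_def less_max_iff_disj)
  ultimately have "R\<^sup>2 * dhalf_period R > 0" by linarith
  then show ?thesis by (simp add: zero_less_mult_iff R)
qed

end

section \<open>Solutions of the Loud system\<close>

lemma real_antiderivative:
  fixes f :: "real \<Rightarrow> real"
  assumes "\<And>x. isCont f x"
  obtains G where "\<And>x. (G has_real_derivative f x) (at x)"
  using einterval_antiderivative[of "-\<infinity>" "\<infinity>" f] assms that
  by (auto simp: has_real_derivative_iff_has_vector_derivative)

lemma periodic_attains_sup:
  fixes f :: "real \<Rightarrow> real"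
  assumes "\<And>x. isCont f x" "T > 0" "\<And>t. f (t + T) = f t"
  obtains s where "\<And>t. f t \<le> f s"
proof -
  interpret periodic_fun_simple f T by unfold_locales (rule assms(3))
  have "compact {0..T}" "{0..T} \<noteq> {}" "continuous_on {0..T} f"
    using assms by (auto intro: continuous_at_imp_continuous_on)
  then obtain s where s: "\<And>t. t \<in> {0..T} \<Longrightarrow> f t \<le> f s"
    using continuous_attains_sup[of "{0..T}" f] by blast
  have "f t \<le> f s" for t
  proof -
    define n where "n = \<lfloor>t / T\<rfloor>"
    have "of_int n \<le> t / T" "t / T \<le> of_int n + 1" unfolding n_def by linarith+
    then have "of_int n * T \<le> t" "t \<le> of_int n * T + T"
      using assms(2) by (auto simp: field_simps)
    then have "f (t - of_int n * T) \<le> f s" by (intro s) auto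
    then show ?thesis using minus_of_int[of t n] by simp
  qed
  then show ?thesis by (rule that)
qed

lemma DERIV_global_max:
  fixes f :: "real \<Rightarrow> real"
  assumes "(f has_real_derivative l) (at s)" "\<And>t. f t \<le> f s"
  shows "l = 0"
  using DERIV_local_max[OF assms(1), of 1] assms(2) by simp

section \<open>Solutions in coordinates and their uniqueness\<close>

lemma is_sol_iff:
  "is_sol D F \<gamma> \<longleftrightarrow> (\<forall>t.
     ((\<lambda>t. fst (\<gamma> t)) has_real_derivative - snd (\<gamma> t) + fst (\<gamma> t) * snd (\<gamma> t)) (at t) \<and>
     ((\<lambda>t. snd (\<gamma> t)) has_real_derivative fst (\<gamma> t) + D * (fst (\<gamma> t))\<^sup>2 + F * (snd (\<gamma> t))\<^sup>2) (at t))"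
  (is "_ \<longleftrightarrow> (\<forall>t. ?A t \<and> ?B t)")
proof -
  have "(\<gamma> has_vector_derivative loud D F (\<gamma> t)) (at t) \<longleftrightarrow> ?A t \<and> ?B t" for t
  proof
    assume h: "(\<gamma> has_vector_derivative loud D F (\<gamma> t)) (at t)"
    show "?A t \<and> ?B t"
      using bounded_linear.has_vector_derivative[OF bounded_linear_fst h]
        bounded_linear.has_vector_derivative[OF bounded_linear_snd h]
      by (simp add: has_real_derivative_iff_has_vector_derivative loud_def)
  next
    assume "?A t \<and> ?B t"
    then have "((\<lambda>t. (fst (\<gamma> t), snd (\<gamma> t))) has_vector_derivative loud D F (\<gamma> t)) (at t)"
      unfolding loud_def has_real_derivative_iff_has_vector_derivative
      by (intro has_vector_derivative_Pair) auto
    then show "(\<gamma> has_vector_derivative loud D F (\<gamma> t)) (at t)" by simp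
  qed
  then show ?thesis by (simp add: is_sol_def)
qed

lemma is_sol_DERIV:
  assumes "is_sol D F \<gamma>"
  shows "((\<lambda>t. fst (\<gamma> t)) has_real_derivative - snd (\<gamma> t) + fst (\<gamma> t) * snd (\<gamma> t)) (at t)"
    and "((\<lambda>t. snd (\<gamma> t)) has_real_derivative fst (\<gamma> t) + D * (fst (\<gamma> t))\<^sup>2 + F * (snd (\<gamma> t))\<^sup>2) (at t)"
  using assms unfolding is_sol_iff by auto

lemma is_sol_isCont:
  assumes "is_sol D F \<gamma>"
  shows "isCont (\<lambda>t. fst (\<gamma> t)) t" "isCont (\<lambda>t. snd (\<gamma> t)) t"
  using is_sol_DERIV[OF assms] DERIV_isCont by blast+

text \<open>Gronwall's argument in both time directions, with integrating factors
  \<open>exp (- C)\<close> and \<open>exp C\<close> for a primitive \<open>C\<close> of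
  \<open>c\<close>.\<close>

lemma linear_bound_imp_zero:
  fixes h h' c :: "real \<Rightarrow> real"
  assumes h: "\<And>t. (h has_real_derivative h' t) (at t)" and c: "\<And>t. isCont c t"
    and b: "\<And>t. \<bar>h' t\<bar> \<le> c t * h t" and nn: "\<And>t. h t \<ge> 0" and 0: "h 0 = 0"
  shows "h t = 0"
proof -
  obtain C where C: "\<And>t. (C has_real_derivative c t) (at t)" using real_antiderivative[OF c] by blast
  have dec: "\<exists>z. ((\<lambda>t. h t * exp (- C t)) has_real_derivative z) (at s) \<and> z \<le> 0" for s
  proof (intro exI conjI)
    show "((\<lambda>t. h t * exp (- C t)) has_real_derivative exp (- C s) * (h' s - c s * h s)) (at s)"
      by (auto intro!: derivative_eq_intros h C simp: algebra_simps)
    have "h' s \<le> c s * h s" using b[of s] by linarith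
    then show "exp (- C s) * (h' s - c s * h s) \<le> 0" by (intro mult_nonneg_nonpos) auto
  qed
  have inc: "\<exists>z. ((\<lambda>t. h t * exp (C t)) has_real_derivative z) (at s) \<and> z \<ge> 0" for s
  proof (intro exI conjI)
    show "((\<lambda>t. h t * exp (C t)) has_real_derivative exp (C s) * (h' s + c s * h s)) (at s)"
      by (auto intro!: derivative_eq_intros h C simp: algebra_simps)
    have "- h' s \<le> c s * h s" using b[of s] by linarith
    then show "exp (C s) * (h' s + c s * h s) \<ge> 0" by (intro mult_nonneg_nonneg) auto
  qed
  show ?thesis
  proof (cases "t \<ge> 0")
    case True
    have "h t * exp (- C t) \<le> h 0 * exp (- C 0)"
      by (rule DERIV_nonpos_imp_nonincreasing[OF True, where f = "\<lambda>t. h t * exp (- C t)"]) (rule dec)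
    then have "h t \<le> 0" using 0 by (simp add: mult_le_0_iff)
    then show ?thesis using nn[of t] by simp
  next
    case False
    then have t: "t \<le> 0" by simp
    have "h t * exp (C t) \<le> h 0 * exp (C 0)"
      by (rule DERIV_nonneg_imp_nondecreasing[OF t, where f = "\<lambda>t. h t * exp (C t)"]) (rule inc)
    then have "h t \<le> 0" using 0 by (simp add: mult_le_0_iff)
    then show ?thesis using nn[of t] by simp
  qed
qed

text \<open>Gronwall for the squared distance \<open>h\<close>: the field is quadratic, so its
  differences are linear in \<open>a\<close> and \<open>b\<close> with coefficients that are
  continuous along the two solutions.\<close>

lemma is_sol_unique:
  assumes \<gamma>: "is_sol D F \<gamma>" and \<eta>: "is_sol D F \<eta>" and eq: "\<gamma> 0 = \<eta> 0"
  shows "\<gamma> t = \<eta> t"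
proof -
  define a where "a t = fst (\<gamma> t) - fst (\<eta> t)" for t
  define b where "b t = snd (\<gamma> t) - snd (\<eta> t)" for t
  define h where "h t = (a t)\<^sup>2 + (b t)\<^sup>2" for t
  define c where "c t = 2 * (\<bar>snd (\<gamma> t)\<bar> + \<bar>fst (\<eta> t)\<bar> + \<bar>D * (fst (\<gamma> t) + fst (\<eta> t))\<bar>
     + \<bar>F * (snd (\<gamma> t) + snd (\<eta> t))\<bar>)" for t
  define h' where "h' t = 2 * ((a t)\<^sup>2 * snd (\<gamma> t) + a t * b t * fst (\<eta> t)
     + a t * b t * (D * (fst (\<gamma> t) + fst (\<eta> t))) + (b t)\<^sup>2 * (F * (snd (\<gamma> t) + snd (\<eta> t))))" for t
  note d = is_sol_DERIV[OF \<gamma>] is_sol_DERIV[OF \<eta>]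
  have da: "(a has_real_derivative - b t + a t * snd (\<gamma> t) + fst (\<eta> t) * b t) (at t)" for t
    unfolding a_def by (rule DERIV_cong[OF DERIV_diff[OF d(1) d(3)]]) (simp add: b_def algebra_simps)
  have db: "(b has_real_derivative a t + D * (fst (\<gamma> t) + fst (\<eta> t)) * a t
      + F * (snd (\<gamma> t) + snd (\<eta> t)) * b t) (at t)" for t
    unfolding b_def by (rule DERIV_cong[OF DERIV_diff[OF d(2) d(4)]])
      (simp add: a_def algebra_simps power2_eq_square)
  have "h t = 0"
  proof (rule linear_bound_imp_zero[where c = c and h = h and h' = h' and t = t])
    fix t
    show "(h has_real_derivative h' t) (at t)"
      unfolding h_def h'_def
      by (auto intro!: derivative_eq_intros da db simp: algebra_simps power2_eq_square)
    show "isCont c t"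
      unfolding c_def by (intro continuous_intros is_sol_isCont[OF \<gamma>] is_sol_isCont[OF \<eta>])
    show "h t \<ge> 0" by (simp add: h_def)
    have ab: "\<bar>a t * b t\<bar> \<le> h t"
    proof -
      have "0 \<le> (\<bar>a t\<bar> - \<bar>b t\<bar>)\<^sup>2" by simp
      then have "2 * (\<bar>a t\<bar> * \<bar>b t\<bar>) \<le> h t" by (simp add: h_def power2_diff)
      then show ?thesis using \<open>h t \<ge> 0\<close> by (simp add: abs_mult)
    qed
    have aa: "\<bar>(a t)\<^sup>2\<bar> \<le> h t" and bb: "\<bar>(b t)\<^sup>2\<bar> \<le> h t" by (auto simp: h_def)
    have m: "\<bar>x * y\<bar> \<le> h t * \<bar>y\<bar>" if "\<bar>x\<bar> \<le> h t" for x y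
      unfolding abs_mult using that by (intro mult_right_mono) auto
    have ct: "c t * h t = 2 * (h t * \<bar>snd (\<gamma> t)\<bar> + h t * \<bar>fst (\<eta> t)\<bar>
        + h t * \<bar>D * (fst (\<gamma> t) + fst (\<eta> t))\<bar> + h t * \<bar>F * (snd (\<gamma> t) + snd (\<eta> t))\<bar>)"
      by (simp add: c_def algebra_simps)
    have tri: "\<bar>2 * (x1 + x2 + x3 + x4)\<bar> \<le> 2 * (y1 + y2 + y3 + y4)"
      if "\<bar>x1\<bar> \<le> y1" "\<bar>x2\<bar> \<le> y2" "\<bar>x3\<bar> \<le> y3" "\<bar>x4\<bar> \<le> y4" for x1 x2 x3 x4 y1 y2 y3 y4 :: real
      using that unfolding abs_le_iff by auto
    show "\<bar>h' t\<bar> \<le> c t * h t"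
      unfolding h'_def ct by (rule tri[OF m[OF aa] m[OF ab] m[OF ab] m[OF bb]])
  qed (simp add: h_def a_def b_def eq)
  then show ?thesis by (simp add: h_def a_def b_def sum_power2_eq_zero_iff prod_eq_iff)
qed

text \<open>Along a solution \<open>(1 - u)' = (1 - u) * v\<close>, which is linear in
  \<open>1 - u\<close>; hence the line \<open>u = 1\<close> is invariant and \<open>1 - u\<close>
  keeps its sign.\<close>

lemma sol_sign_line:
  assumes "is_sol D F \<gamma>"
  shows "\<exists>G. \<forall>t. 1 - fst (\<gamma> t) = (1 - fst (\<gamma> 0)) * exp (G t)"
proof -
  obtain G where G: "\<And>t. (G has_real_derivative snd (\<gamma> t)) (at t)"
    using real_antiderivative[OF is_sol_isCont(2)[OF assms]] by blast
  have "((\<lambda>t. (1 - fst (\<gamma> t)) * exp (- G t)) has_real_derivative 0) (at t)" for t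
    by (auto intro!: derivative_eq_intros G is_sol_DERIV[OF assms] simp: algebra_simps)
  then have c: "(1 - fst (\<gamma> t)) * exp (- G t) = (1 - fst (\<gamma> 0)) * exp (- G 0)" for t
    using DERIV_isconst_all[of "\<lambda>t. (1 - fst (\<gamma> t)) * exp (- G t)"] by blast
  have "1 - fst (\<gamma> t) = (1 - fst (\<gamma> 0)) * exp (G t - G 0)" for t
  proof -
    have "1 - fst (\<gamma> t) = (1 - fst (\<gamma> t)) * exp (- G t) * exp (G t)" by (simp add: exp_minus)
    also have "\<dots> = (1 - fst (\<gamma> 0)) * (exp (- G 0) * exp (G t))" by (simp only: c[of t] mult.assoc)
    also have "exp (- G 0) * exp (G t) = exp (G t - G 0)" by (simp flip: exp_add)
    finally show ?thesis .
  qed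
  then show ?thesis by (intro exI[of _ "\<lambda>t. G t - G 0"]) blast
qed

lemma sol_left_half_plane:
  assumes "is_sol D F \<gamma>" "fst (\<gamma> 0) < 1" shows "fst (\<gamma> t) < 1"
proof -
  obtain G where G: "\<And>t. 1 - fst (\<gamma> t) = (1 - fst (\<gamma> 0)) * exp (G t)"
    using sol_sign_line[OF assms(1)] by blast
  have "1 - fst (\<gamma> t) > 0" unfolding G[of t] using assms(2) by simp
  then show ?thesis by simp
qed

lemma is_sol_shift:
  assumes "is_sol D F \<gamma>" shows "is_sol D F (\<lambda>t. \<gamma> (t + s))"
  unfolding is_sol_iff
proof (intro allI conjI)
  fix t
  note d = is_sol_DERIV[OF assms, of "t + s"]
  show "((\<lambda>t. fst (\<gamma> (t + s))) has_real_derivative - snd (\<gamma> (t + s)) + fst (\<gamma> (t + s)) * snd (\<gamma> (t + s))) (at t)"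
    using d(1) by (simp only: DERIV_shift)
  show "((\<lambda>t. snd (\<gamma> (t + s))) has_real_derivative
      fst (\<gamma> (t + s)) + D * (fst (\<gamma> (t + s)))\<^sup>2 + F * (snd (\<gamma> (t + s)))\<^sup>2) (at t)"
    using d(2) by (simp only: DERIV_shift)
qed

lemma constant_is_sol: "loud D F p = 0 \<Longrightarrow> is_sol D F (\<lambda>_. p)"
  by (auto simp: is_sol_def)

text \<open>On this line the motion is one-dimensional: at a maximum of \<open>v\<close> the whole
  field vanishes, and by uniqueness the solution is constant.\<close>

lemma not_periodic_on_invariant_line:
  assumes "fst p = 1" shows "\<not> is_periodic D F p"
proof
  assume "is_periodic D F p"
  then obtain \<gamma> T where \<gamma>: "is_sol D F \<gamma>" "\<gamma> 0 = p" "T > 0" "\<And>t. \<gamma> (t + T) = \<gamma> t"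
    and nz: "loud D F p \<noteq> 0" unfolding is_periodic_def by blast
  obtain G where "\<And>t. 1 - fst (\<gamma> t) = (1 - fst (\<gamma> 0)) * exp (G t)"
    using sol_sign_line[OF \<gamma>(1)] by blast
  then have u: "fst (\<gamma> t) = 1" for t using \<gamma>(2) assms by simp
  obtain s where s: "\<And>t. snd (\<gamma> t) \<le> snd (\<gamma> s)"
    by (rule periodic_attains_sup[of "\<lambda>t. snd (\<gamma> t)" T]) (use \<gamma> is_sol_isCont[OF \<gamma>(1)] in auto)
  have "fst (\<gamma> s) + D * (fst (\<gamma> s))\<^sup>2 + F * (snd (\<gamma> s))\<^sup>2 = 0"
    by (rule DERIV_global_max[OF is_sol_DERIV(2)[OF \<gamma>(1)] s])
  then have z: "loud D F (\<gamma> s) = 0" by (simp add: loud_def u zero_prod_def)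
  have "is_sol D F (\<lambda>t. \<gamma> (t + s))"
    by (rule is_sol_shift[OF \<gamma>(1)])
  then have "\<gamma> (- s + s) = \<gamma> s"
    using is_sol_unique[OF _ constant_is_sol[OF z], of "\<lambda>t. \<gamma> (t + s)" "- s"] by simp
  then show False using z nz \<gamma>(2) by simp
qed

section \<open>Angular parametrization of the level curves and the period formula\<close>

context loud_field
begin

text \<open>The point \<open>(r, w) = R (cos \<theta>, - sin \<theta>)\<close> carried back to
  \<open>(u, v)\<close> by \<open>u = 1 - exp y\<close> and
  \<open>v = exp (F * y) * w\<close>.\<close>

definition pt :: "real \<Rightarrow> real \<Rightarrow> real \<times> real" where
  "pt R \<theta> = (1 - exp (rad_inv (R * cos \<theta>)), - exp (F * rad_inv (R * cos \<theta>)) * (R * sin \<theta>))"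

definition energy :: "real \<times> real \<Rightarrow> real" where
  "energy p = 2 * pot (ln (1 - fst p)) + (exp (- F * ln (1 - fst p)) * snd p)\<^sup>2"

lemma rad_over_spd: "rad y / spd y = frc y"
  by (cases "y = 0") (auto simp: spd_def)

lemma pt_is_sol:
  assumes rg: "R \<in> range rad" "- R \<in> range rad"
    and \<phi>: "\<And>t. (\<phi> has_real_derivative 1 / lag (R * cos (\<phi> t))) (at t)"
  shows "is_sol D F (\<lambda>t. pt R (\<phi> t))"
proof -
  define y where "y t = rad_inv (R * cos (\<phi> t))" for t
  define v where "v t = - exp (F * y t) * (R * sin (\<phi> t))" for t
  have ry: "rad (y t) = R * cos (\<phi> t)" for t
    unfolding y_def by (rule rad_rad_inv[OF range_rad_cos(1)[OF rg]])
  have sp: "lag (R * cos (\<phi> t)) = spd (y t)" for t by (simp add: lag_def y_def)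
  have s0: "spd (y t) \<noteq> 0" for t using spd_pos[of "y t"] by simp
  have dy: "(y has_real_derivative v t) (at t)" for t
  proof -
    have "((\<lambda>t. R * cos (\<phi> t)) has_real_derivative R * (- sin (\<phi> t) * (1 / spd (y t)))) (at t)"
      using \<phi>[of t] unfolding sp by (auto intro!: derivative_eq_intros)
    from DERIV_chain2[where f = rad_inv and g = "\<lambda>t. R * cos (\<phi> t)",
        OF DERIV_rad_inv[OF range_rad_cos(1)[OF rg]] this]
    have "(y has_real_derivative spd (y t) * exp (F * y t) * (R * (- sin (\<phi> t) * (1 / spd (y t))))) (at t)"
      unfolding y_def by simp
    then show ?thesis by (rule DERIV_cong) (simp add: v_def s0)
  qed
  have dv: "(v has_real_derivative (1 - exp (y t)) + D * (1 - exp (y t))\<^sup>2 + F * (v t)\<^sup>2) (at t)" for t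
  proof -
    have "((\<lambda>t. - exp (F * y t) * (R * sin (\<phi> t))) has_real_derivative
        - (exp (F * y t) * (F * v t)) * (R * sin (\<phi> t))
        + - exp (F * y t) * (R * (cos (\<phi> t) * (1 / spd (y t))))) (at t)"
      by (auto intro!: derivative_eq_intros dy \<phi>[unfolded sp])
    then have d: "(v has_real_derivative - (exp (F * y t) * (F * v t)) * (R * sin (\<phi> t))
        + - exp (F * y t) * (R * (cos (\<phi> t) * (1 / spd (y t))))) (at t)"
      by (simp only: v_def[abs_def])
    have e1: "- (exp (F * y t) * (F * v t)) * (R * sin (\<phi> t)) = F * (v t)\<^sup>2"
      by (simp add: v_def power2_eq_square)
    have e2: "- exp (F * y t) * (R * (cos (\<phi> t) * (1 / spd (y t))))
        = (1 - exp (y t)) + D * (1 - exp (y t))\<^sup>2"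
    proof -
      have "R * (cos (\<phi> t) * (1 / spd (y t))) = frc (y t)"
        using rad_over_spd[of "y t"] by (simp add: ry)
      then have "- exp (F * y t) * (R * (cos (\<phi> t) * (1 / spd (y t))))
          = - ((exp (F * y t) * exp (- F * y t)) * ((exp (y t) - 1) * (1 + D - D * exp (y t))))"
        by (simp add: frc_def)
      also have "exp (F * y t) * exp (- F * y t) = 1" by (simp flip: exp_add)
      finally show ?thesis by (simp add: algebra_simps power2_eq_square)
    qed
    show ?thesis by (rule DERIV_cong[OF d]) (unfold e1 e2, simp)
  qed
  have eq: "pt R (\<phi> t) = (1 - exp (y t), v t)" for t by (simp add: pt_def y_def v_def)
  show ?thesis
    unfolding is_sol_iff eq fst_conv snd_conv
  proof (intro allI conjI dv)
    fix t
    show "((\<lambda>t. 1 - exp (y t)) has_real_derivative - v t + (1 - exp (y t)) * v t) (at t)"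
      by (auto intro!: derivative_eq_intros dy simp: algebra_simps)
  qed
qed

text \<open>The equation \<open>\<theta>' = 1 / K\<close> is separable, so \<open>\<phi>\<close> is
  the inverse of a primitive \<open>\<Theta>\<close> of \<open>lag (R * cos \<theta>)\<close>,
  shifted in time. The positive minimum of \<open>lag\<close> on \<open>[- R, R]\<close> makes
  \<open>\<Theta>\<close> a bijection of the reals, so \<open>\<phi>\<close> exists for all
  times.\<close>

lemma angle_function:
  assumes rg: "R \<in> range rad" "- R \<in> range rad" and R: "R > 0"
  shows "\<exists>\<phi>. \<phi> 0 = \<theta>0 \<and> (\<forall>t. (\<phi> has_real_derivative 1 / lag (R * cos (\<phi> t))) (at t)) \<and>
    strict_mono \<phi> \<and> (\<forall>t. \<phi> (t + 2 * half_period R) = \<phi> t + 2 * pi)"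
proof -
  have "isCont (\<lambda>\<theta>. lag (R * cos \<theta>)) \<theta>" for \<theta>
    by (rule isCont_o2[where f = "\<lambda>\<theta>. R * cos \<theta>" and g = lag])
      (intro continuous_intros isCont_lag range_rad_cos rg)+
  then obtain \<Theta> where \<Theta>: "\<And>\<theta>. (\<Theta> has_real_derivative lag (R * cos \<theta>)) (at \<theta>)"
    using real_antiderivative[of "\<lambda>\<theta>. lag (R * cos \<theta>)"] by blast
  have "continuous_on {-R..R} lag"
    by (rule continuous_on_subset[OF continuous_on_lag]) (use range_rad_between[OF rg(2,1)] in auto)
  then obtain r0 where r0: "\<forall>\<rho>\<in>{-R..R}. lag r0 \<le> lag \<rho>"
    using continuous_attains_inf[of "{-R..R}" lag] R by force
  define m where "m = lag r0"
  have m: "m > 0" by (simp add: m_def lag_pos)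
  have lagm: "m \<le> lag (R * cos \<theta>)" for \<theta>
  proof -
    have "\<bar>R * cos \<theta>\<bar> \<le> R * 1" unfolding abs_mult using R by (intro mult_mono) auto
    then show ?thesis unfolding m_def by (intro r0[rule_format]) auto
  qed
  have grow: "\<Theta> t - \<Theta> s \<ge> m * (t - s)" if "s \<le> t" for s t
  proof -
    have "\<Theta> s - m * s \<le> \<Theta> t - m * t"
    proof (rule DERIV_nonneg_imp_nondecreasing[OF that, where f = "\<lambda>x. \<Theta> x - m * x"])
      fix x
      show "\<exists>z. ((\<lambda>x. \<Theta> x - m * x) has_real_derivative z) (at x) \<and> 0 \<le> z"
        using lagm[of x] by (intro exI[of _ "lag (R * cos x) - m"] conjI) (auto intro!: derivative_eq_intros \<Theta>)
    qed
    then show ?thesis by (simp add: algebra_simps)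
  qed
  have mono: "\<Theta> s < \<Theta> t" if "s < t" for s t
    using grow[of s t] that mult_pos_pos[OF m, of "t - s"] by linarith
  have inj: "inj \<Theta>" by (rule injI) (metis mono linorder_neqE_linordered_idom less_irrefl)
  have ct: "isCont \<Theta> \<theta>" for \<theta> using \<Theta> DERIV_isCont by blast
  have surj: "\<exists>x. \<Theta> x = \<tau>" for \<tau>
  proof -
    define b where "b = \<bar>\<tau> - \<Theta> 0\<bar> / m"
    have b: "b \<ge> 0" "m * b = \<bar>\<tau> - \<Theta> 0\<bar>" using m by (auto simp: b_def)
    have "\<Theta> (- b) \<le> \<tau>" "\<tau> \<le> \<Theta> b" using grow[of "-b" 0] grow[of 0 b] b by auto
    then show ?thesis using IVT[of \<Theta> "- b" \<tau> b] b ct by auto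
  qed
  define \<psi> where "\<psi> = inv \<Theta>"
  have \<psi>1: "\<Theta> (\<psi> \<tau>) = \<tau>" for \<tau>
    unfolding \<psi>_def by (rule f_inv_into_f) (use surj[of \<tau>] in auto)
  have \<psi>2: "\<psi> (\<Theta> \<theta>) = \<theta>" for \<theta> unfolding \<psi>_def using inj by simp
  have \<psi>c: "isCont \<psi> \<tau>" for \<tau>
    using isCont_inverse_function[of 1 "\<psi> \<tau>" \<psi> \<Theta>] \<psi>1 \<psi>2 ct by simp
  have \<psi>d: "(\<psi> has_real_derivative 1 / lag (R * cos (\<psi> \<tau>))) (at \<tau>)" for \<tau>
  proof -
    have "(\<psi> has_real_derivative inverse (lag (R * cos (\<psi> \<tau>)))) (at \<tau>)"
      by (rule DERIV_inverse_function[where f = \<Theta> and a = "\<tau> - 1" and b = "\<tau> + 1"])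
        (use \<Theta> lag_pos[of "R * cos (\<psi> \<tau>)"] \<psi>1 \<psi>c in auto)
    then show ?thesis by (simp add: inverse_eq_divide)
  qed
  \<comment> \<open>The increment over a full turn is independent of the start; the reflections
    \<open>2 * pi - x\<close> and \<open>pi - x\<close> reduce it to \<open>[0, pi]\<close> and then
    to \<open>[0, pi/2]\<close>.\<close>
  have \<Theta>p: "\<Theta> (\<theta> + 2 * pi) = \<Theta> \<theta> + 2 * half_period R" for \<theta>
  proof -
    have sh: "((\<lambda>x. \<Theta> (x + 2 * pi)) has_real_derivative lag (R * cos x)) (at x)" for x
      using DERIV_shift[THEN iffD1, OF \<Theta>[of "x + 2 * pi"]] by simp
    have "((\<lambda>x. \<Theta> (x + 2 * pi) - \<Theta> x) has_real_derivative lag (R * cos x) - lag (R * cos x)) (at x)" for x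
      by (intro DERIV_diff sh \<Theta>)
    then have "\<Theta> (\<theta> + 2 * pi) - \<Theta> \<theta> = \<Theta> (0 + 2 * pi) - \<Theta> 0"
      by (intro DERIV_isconst_all[of "\<lambda>x. \<Theta> (x + 2 * pi) - \<Theta> x"]) simp
    moreover have refl: "((\<lambda>x. \<Theta> (c - x)) has_real_derivative - lag (R * cos (c - x))) (at x)" for c x
      by (rule DERIV_cong[OF DERIV_chain2[where g = "\<lambda>x. c - x", OF \<Theta>]])
        (auto intro!: derivative_eq_intros)
    have "((\<lambda>x. \<Theta> x + \<Theta> (2 * pi - x)) has_real_derivative
        lag (R * cos x) + - lag (R * cos (2 * pi - x))) (at x)" for x
      by (intro DERIV_add refl \<Theta>)
    then have "\<Theta> 0 + \<Theta> (2 * pi - 0) = \<Theta> pi + \<Theta> (2 * pi - pi)"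
      by (intro DERIV_isconst_all[of "\<lambda>x. \<Theta> x + \<Theta> (2 * pi - x)"]) (simp add: cos_2pi_minus)
    moreover have "half_period R = \<Theta> pi - \<Theta> 0"
    proof -
      have "((\<lambda>\<theta>. lag (R * cos \<theta>) + lag (- (R * cos \<theta>))) has_integral
          (\<Theta> (pi/2) - \<Theta> (pi - pi/2)) - (\<Theta> 0 - \<Theta> (pi - 0))) {0..pi/2}"
      proof (rule fundamental_theorem_of_calculus[where f = "\<lambda>\<theta>. \<Theta> \<theta> - \<Theta> (pi - \<theta>)"])
        fix x :: real
        have "((\<lambda>\<theta>. \<Theta> \<theta> - \<Theta> (pi - \<theta>)) has_real_derivative
            lag (R * cos x) - - lag (R * cos (pi - x))) (at x)"
          by (intro DERIV_diff refl \<Theta>)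
        then have "((\<lambda>\<theta>. \<Theta> \<theta> - \<Theta> (pi - \<theta>)) has_real_derivative
            lag (R * cos x) + lag (- (R * cos x))) (at x)" by simp
        then show "((\<lambda>\<theta>. \<Theta> \<theta> - \<Theta> (pi - \<theta>)) has_vector_derivative
            lag (R * cos x) + lag (- (R * cos x))) (at x within {0..pi/2})"
          unfolding has_real_derivative_iff_has_vector_derivative by (rule has_vector_derivative_at_within)
      qed simp
      then show ?thesis unfolding half_period_def by (simp add: integral_unique)
    qed
    ultimately show ?thesis by simp
  qed
  show ?thesis
  proof (intro exI[of _ "\<lambda>t. \<psi> (t + \<Theta> \<theta>0)"] conjI allI)
    show "\<psi> (0 + \<Theta> \<theta>0) = \<theta>0" by (simp add: \<psi>2)
    show "((\<lambda>t. \<psi> (t + \<Theta> \<theta>0)) has_real_derivative 1 / lag (R * cos (\<psi> (t + \<Theta> \<theta>0)))) (at t)" for t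
      using DERIV_shift[THEN iffD1, OF \<psi>d[of "t + \<Theta> \<theta>0"]] .
    show "strict_mono (\<lambda>t. \<psi> (t + \<Theta> \<theta>0))"
    proof (rule strict_monoI)
      fix s t :: real assume "s < t"
      then have "\<Theta> (\<psi> (s + \<Theta> \<theta>0)) < \<Theta> (\<psi> (t + \<Theta> \<theta>0))" by (simp add: \<psi>1)
      then show "\<psi> (s + \<Theta> \<theta>0) < \<psi> (t + \<Theta> \<theta>0)" by (metis mono not_less_iff_gr_or_eq)
    qed
    fix t
    have "\<Theta> (\<psi> (t + \<Theta> \<theta>0) + 2 * pi) = t + 2 * half_period R + \<Theta> \<theta>0"
      by (simp add: \<Theta>p \<psi>1)
    then show "\<psi> (t + 2 * half_period R + \<Theta> \<theta>0) = \<psi> (t + \<Theta> \<theta>0) + 2 * pi"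
      by (metis \<psi>2)
  qed
qed

lemma pt_eq_imp:
  assumes rg: "R \<in> range rad" "- R \<in> range rad" and R: "R > 0" and eq: "pt R a = pt R b"
  obtains n :: int where "a = b + 2 * pi * n"
proof -
  have e: "rad_inv (R * cos a) = rad_inv (R * cos b)" using eq by (simp add: pt_def)
  then have "rad (rad_inv (R * cos a)) = rad (rad_inv (R * cos b))" by simp
  then have "R * cos a = R * cos b" using range_rad_cos[OF rg] by (simp only: rad_rad_inv)
  then have "cos a = cos b" using R by simp
  moreover have "sin a = sin b" using eq e R by (simp add: pt_def)
  ultimately show ?thesis using sin_cos_eq_iff[of a b] that by blast
qed

lemma pt_surj:
  assumes "fst p < 1" "R = sqrt (energy p)" "R > 0"
  obtains \<theta> where "pt R \<theta> = p"
proof -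
  define y w where "y = ln (1 - fst p)" and "w = exp (- F * y) * snd p"
  have ey: "exp y = 1 - fst p" using assms by (simp add: y_def)
  have "energy p > 0" using assms by simp
  then have "R\<^sup>2 = energy p" using assms by simp
  then have R2: "R\<^sup>2 = rad y ^ 2 + w\<^sup>2" by (simp add: energy_def rad_sq y_def w_def)
  have "(rad y / R)\<^sup>2 + (- w / R)\<^sup>2 = (rad y ^ 2 + w\<^sup>2) / R\<^sup>2"
    by (simp only: power_divide power2_minus add_divide_distrib)
  also have "\<dots> = 1" unfolding R2[symmetric] using assms(3) by simp
  finally have "(rad y / R)\<^sup>2 + (- w / R)\<^sup>2 = 1" .
  then obtain t where t: "rad y / R = cos t" "- w / R = sin t" using sincos_total_2pi by metis
  then have c: "R * cos t = rad y" and s: "R * sin t = - w" using assms(3) by (auto simp: field_simps)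
  have "pt R t = (1 - exp y, exp (F * y) * w)" by (simp add: pt_def c s)
  also have "exp (F * y) * w = snd p" by (simp add: w_def exp_minus)
  finally have "pt R t = p" by (simp add: ey prod_eq_iff)
  then show ?thesis by (rule that)
qed

lemma loud_nonzero:
  assumes "fst p < 1" "p \<noteq> 0" shows "loud D F p \<noteq> 0"
proof
  assume "loud D F p = 0"
  then have 1: "snd p * (fst p - 1) = 0" and 2: "fst p + D * (fst p)\<^sup>2 + F * (snd p)\<^sup>2 = 0"
    by (simp_all add: loud_def zero_prod_def algebra_simps)
  from 1 assms have v: "snd p = 0" by simp
  with 2 have "fst p * (1 + D * fst p) = 0" by (simp add: algebra_simps power2_eq_square)
  moreover have "1 + D * fst p > 0"
    using D_gt mult_strict_left_mono_neg[OF assms(1) D_lt] by simp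
  ultimately show False using v assms by (simp add: prod_eq_iff)
qed

lemma energy_pos: assumes "fst p < 1" "p \<noteq> 0" shows "energy p > 0"
proof (cases "fst p = 0")
  case True
  then have "snd p \<noteq> 0" using assms by (auto simp: prod_eq_iff)
  then show ?thesis using True by (simp add: energy_def)
next
  case False
  then have "ln (1 - fst p) \<noteq> 0" using assms by simp
  then show ?thesis using pot_pos by (auto simp: energy_def intro!: add_pos_nonneg)
qed

text \<open>The angle gains \<open>2 * pi\<close> in time \<open>2 * half_period R\<close>. No
  period is smaller: by uniqueness any periodic solution from \<open>p\<close> is the one built from
  \<open>pt\<close>, and on returning its increasing angle has gained a positive multiple of
  \<open>2 * pi\<close>.\<close>

lemma period_formula:
  assumes p: "fst p < 1" "p \<noteq> 0" and R: "R = sqrt (energy p)"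
    and rg: "R \<in> range rad" "- R \<in> range rad"
  shows "is_periodic D F p" and "period D F p = 2 * half_period R"
proof -
  have R0: "R > 0" using energy_pos[OF p] R by simp
  obtain \<theta> where \<theta>: "pt R \<theta> = p" by (rule pt_surj[OF p(1) R R0])
  obtain \<phi> where \<phi>: "\<phi> 0 = \<theta>" "\<And>t. (\<phi> has_real_derivative 1 / lag (R * cos (\<phi> t))) (at t)"
    "strict_mono \<phi>" "\<And>t. \<phi> (t + 2 * half_period R) = \<phi> t + 2 * pi"
    using angle_function[OF rg R0, of \<theta>] by blast
  define T where "T = 2 * half_period R"
  define \<gamma> where "\<gamma> t = pt R (\<phi> t)" for t
  have sol: "is_sol D F \<gamma>" unfolding \<gamma>_def[abs_def] by (rule pt_is_sol[OF rg \<phi>(2)])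
  have g0: "\<gamma> 0 = p" by (simp add: \<gamma>_def \<phi> \<theta>)
  have \<phi>T: "\<phi> (t + T) = \<phi> t + 2 * pi" for t using \<phi>(4) by (simp add: T_def)
  have per: "\<gamma> (t + T) = \<gamma> t" for t unfolding \<gamma>_def \<phi>T by (simp add: pt_def)
  have "\<phi> 0 < \<phi> (0 + T)" unfolding \<phi>T by simp
  then have T0: "T > 0" using \<phi>(3) by (simp add: strict_mono_less)
  show "is_periodic D F p"
    unfolding is_periodic_def using loud_nonzero[OF p] sol g0 T0 per by blast
  have "Inf {T. T > 0 \<and> (\<exists>\<gamma>. is_sol D F \<gamma> \<and> \<gamma> 0 = p \<and> (\<forall>t. \<gamma> (t + T) = \<gamma> t))} = T"
  proof (rule cInf_eq_minimum)
    show "T \<in> {T. T > 0 \<and> (\<exists>\<gamma>. is_sol D F \<gamma> \<and> \<gamma> 0 = p \<and> (\<forall>t. \<gamma> (t + T) = \<gamma> t))}"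
      using sol g0 T0 per by blast
    fix S assume "S \<in> {T. T > 0 \<and> (\<exists>\<gamma>. is_sol D F \<gamma> \<and> \<gamma> 0 = p \<and> (\<forall>t. \<gamma> (t + T) = \<gamma> t))}"
    then obtain \<eta> where S: "S > 0" "is_sol D F \<eta>" "\<eta> 0 = p" "\<And>t. \<eta> (t + S) = \<eta> t" by blast
    have "\<gamma> t = \<eta> t" for t using is_sol_unique[OF sol S(2)] g0 S(3) by simp
    then have "\<gamma> S = \<gamma> 0" using S(4)[of 0] by simp
    then obtain n :: int where n: "\<phi> S = \<phi> 0 + 2 * pi * n"
      unfolding \<gamma>_def using pt_eq_imp[OF rg R0] by blast
    have "\<phi> 0 < \<phi> S" using \<phi>(3) S(1) by (simp add: strict_mono_less)
    with n have "n > 0" by (simp add: zero_less_mult_iff)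
    then have "2 * pi * 1 \<le> 2 * pi * n" by (intro mult_left_mono) auto
    then have "\<phi> (0 + T) \<le> \<phi> S" unfolding \<phi>T n by simp
    then show "T \<le> S" using \<phi>(3) by (simp add: strict_mono_less_eq)
  qed
  then show "period D F p = 2 * half_period R" by (simp add: period_def T_def)
qed

lemma energy_conserved:
  assumes "is_sol D F \<gamma>" "fst (\<gamma> 0) < 1"
  shows "energy (\<gamma> t) = energy (\<gamma> 0)"
    and "((\<lambda>t. ln (1 - fst (\<gamma> t))) has_real_derivative snd (\<gamma> t)) (at t)"
proof -
  define y where "y t = ln (1 - fst (\<gamma> t))" for t
  have u: "fst (\<gamma> t) < 1" for t by (rule sol_left_half_plane[OF assms])
  have ey: "fst (\<gamma> t) = 1 - exp (y t)" for t using u[of t] by (simp add: y_def)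
  have dy: "(y has_real_derivative snd (\<gamma> t)) (at t)" for t
  proof -
    have "(y has_real_derivative 1 / (1 - fst (\<gamma> t)) * (0 - (- snd (\<gamma> t) + fst (\<gamma> t) * snd (\<gamma> t)))) (at t)"
      unfolding y_def[abs_def] using u[of t]
      by (intro DERIV_chain2[where f = ln and g = "\<lambda>t. 1 - fst (\<gamma> t)"] DERIV_diff DERIV_const
          is_sol_DERIV[OF assms(1)] DERIV_ln_divide) auto
    then show ?thesis by (rule DERIV_cong) (use u[of t] in \<open>simp add: field_simps\<close>)
  qed
  then show "((\<lambda>t. ln (1 - fst (\<gamma> t))) has_real_derivative snd (\<gamma> t)) (at t)"
    by (simp add: y_def[abs_def])
  have en: "energy (\<gamma> t) = 2 * pot (y t) + (exp (- F * y t) * snd (\<gamma> t))\<^sup>2" for t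
    by (simp add: energy_def y_def)
  have "((\<lambda>t. 2 * pot (y t) + (exp (- F * y t) * snd (\<gamma> t))\<^sup>2) has_real_derivative 0) (at t)" for t
  proof -
    define e where "e = exp (- F * y t)"
    have dp: "((\<lambda>t. pot (y t)) has_real_derivative e * frc (y t) * snd (\<gamma> t)) (at t)"
      unfolding e_def by (rule DERIV_chain2[OF DERIV_pot dy])
    have "((\<lambda>t. exp (- F * y t)) has_real_derivative e * (- F * snd (\<gamma> t))) (at t)"
      unfolding e_def by (auto intro!: derivative_eq_intros dy)
    note dw = DERIV_mult[OF this is_sol_DERIV(2)[OF assms(1), of t]]
    have fr: "frc (y t) = - (e * (fst (\<gamma> t) + D * (fst (\<gamma> t))\<^sup>2))"
      unfolding frc_def ey e_def by (simp add: algebra_simps power2_eq_square)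
    show ?thesis
      by (rule DERIV_cong[OF DERIV_add[OF DERIV_cmult[OF dp] DERIV_power[OF dw]]])
        (simp add: fr e_def algebra_simps power2_eq_square)
  qed
  then show "energy (\<gamma> t) = energy (\<gamma> 0)"
    unfolding en using DERIV_isconst_all[of "\<lambda>t. 2 * pot (y t) + (exp (- F * y t) * snd (\<gamma> t))\<^sup>2"] by blast
qed

text \<open>At the extrema of \<open>y\<close> over a period \<open>v = y' = 0\<close>, so all
  energy is potential. The extrema differ, else \<open>p\<close> would be an equilibrium, and strict
  monotonicity of \<open>pot\<close> on each side of 0 forces opposite signs. Hence both square
  roots of the energy lie in the range of \<open>rad\<close>, also when that range is
  bounded.\<close>

lemma periodic_turning_points:
  assumes "is_periodic D F p" "fst p < 1"
  obtains ym yp where "ym < 0" "yp > 0" "rad yp = sqrt (energy p)" "rad ym = - sqrt (energy p)"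
    "(1 - exp ym, 0) \<in> orbit D F p"
proof -
  from assms(1) obtain \<gamma> T where \<gamma>: "is_sol D F \<gamma>" "\<gamma> 0 = p" "T > 0" "\<And>t. \<gamma> (t + T) = \<gamma> t"
    and nz: "loud D F p \<noteq> 0" unfolding is_periodic_def by blast
  define y where "y t = ln (1 - fst (\<gamma> t))" for t
  have u: "fst (\<gamma> t) < 1" for t using sol_left_half_plane[OF \<gamma>(1)] assms \<gamma>(2) by simp
  note ec = energy_conserved[OF \<gamma>(1) u]
  have dy: "(y has_real_derivative snd (\<gamma> t)) (at t)" for t
    unfolding y_def[abs_def] by (rule ec)
  have yc: "isCont y t" for t using dy DERIV_isCont by blast
  have yT: "y (t + T) = y t" for t by (simp add: y_def \<gamma>)
  obtain s1 where s1: "\<And>t. y t \<le> y s1" by (rule periodic_attains_sup[OF yc \<gamma>(3) yT]) blast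
  obtain s2 where s2: "\<And>t. - y t \<le> - y s2"
    by (rule periodic_attains_sup[of "\<lambda>t. - y t", OF _ \<gamma>(3)]) (auto simp: yT intro: continuous_intros yc)
  have v1: "snd (\<gamma> s1) = 0" by (rule DERIV_global_max[OF dy s1])
  have v2: "snd (\<gamma> s2) = 0" using DERIV_global_max[OF DERIV_minus[OF dy] s2] by simp
  have e1: "energy p = 2 * pot (y s1)" using ec(1)[of s1] v1 \<gamma>(2) by (simp add: energy_def y_def)
  have e2: "energy p = 2 * pot (y s2)" using ec(1)[of s2] v2 \<gamma>(2) by (simp add: energy_def y_def)
  have ne: "y s2 \<noteq> y s1"
  proof
    assume "y s2 = y s1"
    then have "y t = y s1" for t using s1[of t] s2[of t] by simp
    then have yc: "y = (\<lambda>_. y s1)" by auto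
    have v: "snd (\<gamma> t) = 0" for t using dy[of t] DERIV_const DERIV_unique yc by metis
    then have "(\<lambda>t. snd (\<gamma> t)) = (\<lambda>_. 0)" by auto
    then have "fst (\<gamma> 0) + D * (fst (\<gamma> 0))\<^sup>2 + F * (snd (\<gamma> 0))\<^sup>2 = 0"
      using is_sol_DERIV(2)[OF \<gamma>(1), of 0] DERIV_unique[OF _ DERIV_const] by metis
    then show False using nz v[of 0] \<gamma>(2) by (simp add: loud_def zero_prod_def)
  qed
  then have lt: "y s2 < y s1" using s1[of s2] by simp
  have m: "y s2 < 0"
  proof (rule ccontr)
    assume "\<not> y s2 < 0"
    then show False using pot_strict_mono[of "y s2" "y s1"] lt e1 e2 by simp
  qed
  have M: "y s1 > 0"
  proof (rule ccontr)
    assume "\<not> y s1 > 0"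
    then show False using pot_strict_antimono[of "y s2" "y s1"] lt e1 e2 by simp
  qed
  show ?thesis
  proof (rule that[of "y s2" "y s1"])
    show "rad (y s1) = sqrt (energy p)" using M by (simp add: rad_def e1)
    show "rad (y s2) = - sqrt (energy p)" using m by (simp add: rad_def e2)
    have "\<gamma> s2 = (1 - exp (y s2), 0)" using v2 u[of s2] by (simp add: y_def prod_eq_iff)
    then show "(1 - exp (y s2), 0) \<in> orbit D F p"
      unfolding orbit_def using \<gamma> by force
  qed (use m M in auto)
qed

end

section \<open>The period annulus and its critical periods\<close>

text \<open>\<open>S\<close> is connected and has points with \<open>u = 0\<close> near the origin;
  to reach \<open>u \<ge> 1\<close> it would have to meet the line \<open>u = 1\<close>, which
  carries no periodic point.\<close>

lemma period_annulus_cases: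
  assumes "p \<in> period_annulus D F"
  obtains S where "punct_nbhd_periodic D F S" "p \<in> S" "\<And>q. q \<in> S \<Longrightarrow> fst q < 1"
proof -
  obtain S where S: "punct_nbhd_periodic D F S" "p \<in> S"
    using assms by (auto simp: period_annulus_def)
  obtain e where e: "e > 0" "ball 0 e - {0} \<subseteq> S" and con: "connected S"
    and per: "\<And>q. q \<in> S \<Longrightarrow> is_periodic D F q"
    using S(1) unfolding punct_nbhd_periodic_def by blast
  have "(0, e / 2) \<in> ball 0 e - {0::real \<times> real}"
    using e(1) by (auto simp: dist_norm norm_Pair zero_prod_def)
  then have 0: "0 \<in> fst ` S" using e(2) by force
  have "fst q < 1" if q: "q \<in> S" for q
  proof (rule ccontr)
    assume "\<not> fst q < 1"
    then have "1 \<in> fst ` S"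
      using connectedD_interval[OF connected_linear_image[OF linear_fst con] 0, of "fst q" 1] q by auto
    then show False using per not_periodic_on_invariant_line by force
  qed
  with S show ?thesis by (rule that)
qed

context loud_field
begin

text \<open>The gradient of \<open>energy\<close> is the field turned by a right angle times a
  positive integrating factor, so a curve transversal to the flow changes the energy at nonzero
  rate.\<close>

lemma energy_DERIV_along:
  assumes \<sigma>: "(\<sigma> has_vector_derivative w) (at 0)" and u: "fst (\<sigma> 0) < 1"
  shows "((\<lambda>s. energy (\<sigma> s)) has_real_derivative
    2 * exp (- F * ln (1 - fst (\<sigma> 0))) ^ 2 / (1 - fst (\<sigma> 0)) *
      (fst w * snd (loud D F (\<sigma> 0)) - snd w * fst (loud D F (\<sigma> 0)))) (at 0)"
proof -
  define y where "y s = ln (1 - fst (\<sigma> s))" for s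
  define a where "a = 1 - fst (\<sigma> 0)"
  define e where "e = exp (- F * y 0)"
  have a: "a > 0" using u by (simp add: a_def)
  have ea: "exp (y 0) = a" using a by (simp add: y_def a_def)
  have d1: "((\<lambda>s. fst (\<sigma> s)) has_real_derivative fst w) (at 0)"
    and d2: "((\<lambda>s. snd (\<sigma> s)) has_real_derivative snd w) (at 0)"
    using bounded_linear.has_vector_derivative[OF bounded_linear_fst \<sigma>]
      bounded_linear.has_vector_derivative[OF bounded_linear_snd \<sigma>]
    by (simp_all add: has_real_derivative_iff_has_vector_derivative)
  have dy: "(y has_real_derivative 1 / a * (0 - fst w)) (at 0)"
    unfolding y_def[abs_def] a_def using u
    by (intro DERIV_chain2[where f = ln and g = "\<lambda>s. 1 - fst (\<sigma> s)"] DERIV_diff DERIV_const d1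
        DERIV_ln_divide) auto
  have dp: "((\<lambda>s. pot (y s)) has_real_derivative e * frc (y 0) * (1 / a * (0 - fst w))) (at 0)"
    unfolding e_def by (rule DERIV_chain2[OF DERIV_pot dy])
  have "((\<lambda>s. exp (- F * y s)) has_real_derivative e * (- F * (1 / a * (0 - fst w)))) (at 0)"
    unfolding e_def by (rule DERIV_chain2[OF DERIV_exp]) (intro DERIV_cmult dy)
  note dw = DERIV_mult[OF this d2]
  have fr: "frc (y 0) = e * ((a - 1) * (1 + D - D * a))" by (simp add: frc_def e_def ea)
  have f0: "fst (\<sigma> 0) = 1 - a" by (simp add: a_def)
  have en: "(\<lambda>s. energy (\<sigma> s)) = (\<lambda>s. 2 * pot (y s) + (exp (- F * y s) * snd (\<sigma> s))\<^sup>2)"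
    by (simp add: energy_def y_def fun_eq_iff)
  have "((\<lambda>s. energy (\<sigma> s)) has_real_derivative 2 * e ^ 2 / a *
      (fst w * snd (loud D F (\<sigma> 0)) - snd w * fst (loud D F (\<sigma> 0)))) (at 0)"
    unfolding en
    by (rule DERIV_cong[OF DERIV_add[OF DERIV_cmult[OF dp] DERIV_power[OF dw]]])
      (use a in \<open>simp add: fr loud_def f0 flip: e_def\<close>,
        use a in \<open>simp add: field_simps power2_eq_square e_def\<close>)
  then show ?thesis by (simp add: e_def a_def y_def)
qed

text \<open>Throughout the open set \<open>S\<close> the period is a function of the energy alone;
  by the chain rule its derivative along any transversal curve is a product of nonzero
  factors.\<close>

lemma not_critical:
  assumes S: "open S" "p \<in> S" "0 \<notin> S" "\<And>q. q \<in> S \<Longrightarrow> is_periodic D F q" "\<And>q. q \<in> S \<Longrightarrow> fst q < 1"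
    and pos: "dhalf_period (sqrt (energy p)) > 0"
  shows "\<not> critical_period D F p"
proof
  assume "critical_period D F p"
  then obtain \<sigma> w where \<sigma>: "\<sigma> 0 = p" "(\<sigma> has_vector_derivative w) (at 0)"
    and tr: "fst w * snd (loud D F p) - snd w * fst (loud D F p) \<noteq> 0"
    and z: "((\<lambda>s. period D F (\<sigma> s)) has_real_derivative 0) (at 0)"
    unfolding critical_period_def by blast
  have rg: "sqrt (energy q) \<in> range rad" "- sqrt (energy q) \<in> range rad" if "q \<in> S" for q
    using periodic_turning_points[OF S(4,5)[OF that]] by (metis rangeI)+
  have per: "period D F q = 2 * half_period (sqrt (energy q))" if "q \<in> S" for q
    using S that by (intro period_formula rg) auto
  have ep: "energy p > 0" using S by (intro energy_pos) auto
  define c where "c = 2 * exp (- F * ln (1 - fst p)) ^ 2 / (1 - fst p) *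
      (fst w * snd (loud D F p) - snd w * fst (loud D F p))"
  have "fst p < 1" using S by auto
  then have c: "c \<noteq> 0" using tr by (simp add: c_def)
  have "((\<lambda>s. energy (\<sigma> s)) has_real_derivative c) (at 0)"
    using energy_DERIV_along[OF \<sigma>(2)] \<open>fst p < 1\<close> unfolding \<sigma>(1) c_def by simp
  then have dR: "((\<lambda>s. sqrt (energy (\<sigma> s))) has_real_derivative inverse (sqrt (energy p)) / 2 * c) (at 0)"
    by (intro DERIV_chain2[where f = sqrt and g = "\<lambda>s. energy (\<sigma> s)"])
      (use ep in \<open>auto simp: \<sigma>(1) intro!: DERIV_real_sqrt\<close>)
  have "(half_period has_real_derivative dhalf_period (sqrt (energy p))) (at (sqrt (energy (\<sigma> 0))))"
    unfolding \<sigma>(1) using ep by (intro DERIV_half_period rg S) auto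
  from DERIV_cmult[OF DERIV_chain2[where g = "\<lambda>s. sqrt (energy (\<sigma> s))", OF this dR], of 2]
  have d: "((\<lambda>s. 2 * half_period (sqrt (energy (\<sigma> s)))) has_real_derivative
     2 * (dhalf_period (sqrt (energy p)) * (inverse (sqrt (energy p)) / 2 * c))) (at 0)" .
  have "isCont \<sigma> 0" using \<sigma>(2) by (rule has_vector_derivative_continuous)
  then have "eventually (\<lambda>s. \<sigma> s \<in> S) (at 0)"
    unfolding isCont_def by (rule topological_tendstoD) (use S \<sigma> in auto)
  then have "eventually (\<lambda>s. \<sigma> s \<in> S) (nhds 0)"
    unfolding eventually_nhds_conv_at using S \<sigma> by simp
  then have "eventually (\<lambda>s. 2 * half_period (sqrt (energy (\<sigma> s))) = period D F (\<sigma> s)) (nhds 0)"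
    by (rule eventually_mono) (simp add: per)
  from DERIV_cong_ev[OF refl this refl, THEN iffD1, OF d]
  have "2 * (dhalf_period (sqrt (energy p)) * (inverse (sqrt (energy p)) / 2 * c)) = 0"
    using z by (rule DERIV_unique)
  then show False using pos c ep by simp
qed

section \<open>The period annulus for \<open>F = 0\<close>\<close>

lemma range_rad_UNIV:
  assumes "F = 0" shows "range rad = UNIV"
proof -
  have "\<rho> \<in> range rad" for \<rho>
  proof -
    \<comment> \<open>\<open>b\<close> makes the lower bound \<open>- D * b^2 / 2\<close> of
      \<open>pot b\<close> equal to \<open>\<rho>^2 / 2\<close>; \<open>a\<close> makes
      \<open>2 * (1 + D) * lin_part a\<close> equal to \<open>\<rho>^2 + 4\<close>, where 4 absorbs
      \<open>rest_part\<close>.\<close>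
    define b where "b = \<bar>\<rho>\<bar> / sqrt (- D)"
    define a where "a = - ((\<rho>\<^sup>2 + 4) / (2 * (1 + D)))"
    have b: "b \<ge> 0" "- D * b\<^sup>2 = \<rho>\<^sup>2" using D_lt by (auto simp: b_def power_divide)
    have "- D * (b\<^sup>2 / 2) \<le> - D * (exp b - 1 - b)"
      using exp_lower_Taylor_quadratic[OF b(1)] D_lt by (intro mult_left_mono) auto
    also have "\<dots> \<le> pot b" using D_lt b by (intro pot_right_ge) auto
    finally have "\<rho>\<^sup>2 \<le> rad b ^ 2" using b by (simp add: rad_sq)
    then have 1: "\<bar>\<rho>\<bar> \<le> rad b"
      using b rad_le_iff[of 0 b] by (intro power2_le_imp_le[of "\<bar>\<rho>\<bar>"]) (auto simp del: rad_le_iff)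
    have "(\<rho>\<^sup>2 + 4) / (2 * (1 + D)) > 0" using D_gt by (intro divide_pos_pos add_nonneg_pos) auto
    then have a: "a < 0" by (simp add: a_def)
    have la: "lin_part a = - a" unfolding lin_part_def by (simp add: exp_prim_def assms)
    have "2 * (1 + D) * lin_part a = \<rho>\<^sup>2 + 4" unfolding la using D_gt by (simp add: a_def)
    then have "\<rho>\<^sup>2 \<le> 2 * pot a" using pot_split[of a] rest_part_bound[of a] a by simp
    then have "\<bar>\<rho>\<bar> \<le> sqrt (2 * pot a)" by (intro real_le_rsqrt) auto
    then have 2: "rad a \<le> - \<bar>\<rho>\<bar>" using a by (simp add: rad_def)
    show ?thesis by (rule range_rad_between[of "rad a" "rad b"]) (use 1 2 in auto)
  qed
  then show ?thesis by auto
qed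

text \<open>For \<open>F = 0\<close> all positive energy levels in \<open>u < 1\<close> close up. So
  the annulus at \<open>a0\<close> contains this punctured half-plane, which keeps its outer
  boundary off the segment removed in the main proof.\<close>

lemma half_plane_periodic:
  assumes "F = 0" shows "punct_nbhd_periodic D F ({p. fst p < 1} - {0})"
  unfolding punct_nbhd_periodic_def
proof (intro conjI ballI)
  have o: "open {p :: real \<times> real. fst p < 1}"
    by (intro open_Collect_less continuous_intros)
  then show "open ({p :: real \<times> real. fst p < 1} - {0})" by blast
  have "convex {p :: real \<times> real. fst p < 1}"
  proof -
    have "convex (fst -` {..<1::real} :: (real \<times> real) set)"
      by (intro convex_linear_vimage linear_fst) auto
    then show ?thesis by (simp add: vimage_def)
  qed
  then have "connected {p :: real \<times> real. fst p < 1}" by (rule convex_connected)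
  then show "connected ({p :: real \<times> real. fst p < 1} - {0})"
    using o by (intro connected_open_diff_countable) auto
  show "\<exists>e>0. ball 0 e - {0} \<subseteq> {p :: real \<times> real. fst p < 1} - {0}"
  proof (intro exI[of _ 1] conjI subsetI)
    fix x :: "real \<times> real" assume x: "x \<in> ball 0 1 - {0}"
    then have "fst x < 1" using norm_fst_le[of "fst x" "snd x"] by auto
    then show "x \<in> {p. fst p < 1} - {0}" using x by simp
  qed simp
  fix p assume "p \<in> {p :: real \<times> real. fst p < 1} - {0}"
  then have p: "fst p < 1" "p \<noteq> 0" by auto
  show "is_periodic D F p"
    by (rule period_formula[OF p refl]) (simp_all only: range_rad_UNIV[OF assms] UNIV_I)
  show "orbit D F p \<subseteq> {p. fst p < 1} - {0}"
  proof
    fix q assume "q \<in> orbit D F p"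
    then obtain \<gamma> t where g: "is_sol D F \<gamma>" "\<gamma> 0 = p" "\<gamma> t = q" by (auto simp: orbit_def)
    have "fst q < 1" using sol_left_half_plane[OF g(1), of t] g p by simp
    moreover have "energy q > 0" using energy_conserved(1)[OF g(1), of t] g p energy_pos[OF p] by simp
    then have "q \<noteq> 0" by (auto simp: energy_def)
    ultimately show "q \<in> {p. fst p < 1} - {0}" by simp
  qed
qed simp

end

section \<open>The neighbourhood of the outer boundary\<close>

lemma continuous_on_pc: "continuous_on A pc"
  unfolding pc_def
  by (intro continuous_intros) (auto simp: add_pos_nonneg less_imp_neq[symmetric] power2_eq_square sum_power2_eq_zero_iff)

theorem theoremB:
  fixes D0 :: real
  assumes "-1 < D0" and "D0 < 0"
  shows "\<exists>\<delta>>0. \<exists>W. open W \<and> outer_boundary D0 0 \<subseteq> W \<and>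
           (\<forall>D F. \<bar>D - D0\<bar> < \<delta> \<and> \<bar>F\<bar> < \<delta> \<longrightarrow>
              (\<forall>p \<in> period_annulus D F. pc ` orbit D F p \<subseteq> W \<longrightarrow> \<not> critical_period D F p))"
proof -
  \<comment> \<open>Half the distance from \<open>D0\<close> to the ends of \<open>(-1, 0)\<close>,
    so that \<open>d \<le> - D\<close> and \<open>d \<le> 1 + D\<close> hold whenever
    \<open>\<bar>D - D0\<bar> < d\<close>.\<close>
  define d where "d = min (- D0) (1 + D0) / 2"
  define Z where "Z = 320 / d"
  have d: "d > 0" "2 * d \<le> - D0" "2 * d \<le> 1 + D0" using assms by (auto simp: d_def)
  have Z: "Z > 0" using d by (simp add: Z_def)
  obtain Y where Y: "Y \<ge> ln 2"
    "\<And>D F ym yp. loud_field D F \<Longrightarrow> d \<le> - D \<Longrightarrow> ym \<le> - Y \<Longrightarrow> yp \<ge> 0 \<Longrightarrow>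
       loud_field.pot D F yp = loud_field.pot D F ym \<Longrightarrow> yp + Z \<le> - ym"
    by (rule turning_points_gap[OF d(1), of Z]) (use Z in auto)
  \<comment> \<open>Every periodic orbit in the half-plane \<open>u < 1\<close> crosses the segment \<open>0 < u < 1\<close>, \<open>v = 0\<close> at
    \<open>u = 1 - exp ym\<close>; so it suffices that \<open>W\<close> avoids an initial part of this segment.\<close>
  define u1 where "u1 = 1 - exp (- Y)"
  define seg where "seg = (\<lambda>u. pc (u, 0)) ` {0..u1}"
  \<comment> \<open>In turn these keep \<open>D\<close> in range, meet the bound of
    \<open>loud_field\<close>, give \<open>dspd \<le> 0\<close> on the left, and ensure
    \<open>\<bar>F\<bar> * Z \<le> 1/2\<close>.\<close>
  define \<delta> where "\<delta> = min (min d (1/8)) (min (d / 8) (1 / (2 * Z)))"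
  have \<delta>: "\<delta> > 0" using d Z by (simp add: \<delta>_def)
  have "continuous_on {0..u1} (\<lambda>u. pc (u, 0))"
    by (intro continuous_on_compose2[OF continuous_on_pc[of UNIV]] continuous_intros) auto
  then have "compact seg" unfolding seg_def by (intro compact_continuous_image) auto
  then have "open (- seg)" using compact_imp_closed by blast
  moreover have "outer_boundary D0 0 \<subseteq> - seg"
  proof
    fix x assume x: "x \<in> outer_boundary D0 0"
    show "x \<in> - seg"
    proof
      assume "x \<in> seg"
      then obtain u where u: "x = pc (u, 0)" "0 \<le> u" "u \<le> u1" by (auto simp: seg_def)
      interpret loud_field D0 0 using assms by unfold_locales auto
      \<comment> \<open>The origin is in \<open>seg\<close>, which must be closed, but is excluded
        from the outer boundary.\<close>
      have "u \<noteq> 0"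
      proof
        assume "u = 0"
        then have "x = 0" using u by (simp add: pc_def zero_prod_def)
        then show False using x by (simp add: outer_boundary_def)
      qed
      moreover have "u < 1" using u by (simp add: u1_def) (smt (verit) exp_gt_zero)
      ultimately have "(u, 0) \<in> {p. fst p < 1} - {0}" by (simp add: zero_prod_def)
      then have "(u, 0) \<in> period_annulus D0 0"
        unfolding period_annulus_def using half_plane_periodic[OF refl] by blast
      then show False using x u by (simp add: outer_boundary_def)
    qed
  qed
  moreover have "\<not> critical_period D F p"
    if DF: "\<bar>D - D0\<bar> < \<delta>" "\<bar>F\<bar> < \<delta>" and p: "p \<in> period_annulus D F"
      and W: "pc ` orbit D F p \<subseteq> - seg" for D F p
  proof -
    have "\<bar>D - D0\<bar> < d" using DF by (simp add: \<delta>_def)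
    then have D: "d \<le> - D" "d \<le> 1 + D" using d by linarith+
    have F: "\<bar>F\<bar> \<le> 1/8" "\<bar>F\<bar> \<le> d / 8" "\<bar>F\<bar> \<le> 1 / (2 * Z)" using DF by (auto simp: \<delta>_def)
    have lf: "loud_field D F" using D d F by unfold_locales auto
    interpret loud_field D F by (rule lf)
    obtain S where S: "punct_nbhd_periodic D F S" "p \<in> S" "\<And>q. q \<in> S \<Longrightarrow> fst q < 1"
      by (rule period_annulus_cases[OF p]) blast
    then have S': "open S" "0 \<notin> S" "\<And>q. q \<in> S \<Longrightarrow> is_periodic D F q"
      by (auto simp: punct_nbhd_periodic_def)
    obtain ym yp where y: "ym < 0" "yp > 0" "rad yp = sqrt (energy p)" "rad ym = - sqrt (energy p)"
      "(1 - exp ym, 0) \<in> orbit D F p"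
      using periodic_turning_points[OF S'(3)[OF S(2)] S(3)[OF S(2)]] by blast
    have "pc (1 - exp ym, 0) \<notin> seg" using y(5) W by blast
    then have "\<not> 1 - exp ym \<le> u1" using y(1) unfolding seg_def by (metis (no_types) atLeastAtMost_iff
        image_eqI diff_ge_0_iff_ge exp_le_one_iff less_imp_le)
    then have ym: "ym \<le> - Y" by (simp add: u1_def)
    have "2 * pot yp = 2 * pot ym" unfolding rad_sq[symmetric] y by simp
    then have "yp + Z \<le> - ym" using y ym D by (intro Y(2)[OF lf]) auto
    moreover have "\<bar>F\<bar> * Z \<le> 1/2" using F(3) Z by (simp add: field_simps)
    ultimately have "dhalf_period (sqrt (energy p)) > 0"
      using y ym Y(1) by (intro dhalf_period_pos[OF d(1) D F(2) Z_def]) auto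
    then show ?thesis by (intro not_critical[OF S'(1) S(2) S'(2,3) S(3)])
  qed
  ultimately show ?thesis using \<delta> by (intro exI[of _ \<delta>] conjI exI[of _ "- seg"]) auto
qed

end
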